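(* Let $n,m\geq 1$ and $0\leq d\leq n$ be integers, let $K\subset \mathbb{R}^{n-d}$ be a compact set, and let $E:=K\times\mathbb{R}^d$. Let $\mathcal{R} \subset J^2(E, \mathbb{R}^m)$ be a partial differential relation that is semilinear in $x_1$, given by smooth maps $L$ and $R$, and let $f \in C^{\infty}_{per,d}(E,\mathbb{R}^m)$. Assume that there are two well-adapted smooth families of loops $\{\gamma_x\}_{x\in E}$ and $\{\delta_x\}_{x\in E}$ valued in $\mathbb{R}^m$ satisfying the following properties: (L1) For every $x\in E$, $\overline{\gamma_x}=\overline{\delta_x}=0$. (L2) For every $x\in E$ and every $t\in \mathbb{R}$, $L(x) \cdot \gamma_x(t) = \partial_1L(x) \cdot \gamma_x(t)= 0$. (L3) For every $x\in E$ and every $t\in \mathbb{R}$, $$L (x) \cdot \left(\sigma_{11}^2 + \delta_x(t)\right) + R\left(x,\check{\sigma}, \sigma_1^1 +\gamma_x(t), \sigma^2_{1*} +\partial_{*} \gamma_x(t) \right) = 0,$$ where $\sigma:= J^2_f(x)$ and $\partial_{*} \gamma_x(t)$ is the tuple $(\partial_2\gamma_x(t), \ldots, \partial_n\gamma_x(t))$. Then, for every $\epsilon >0$, the smooth function $F\in C^{\infty}_{per,d} (E, \mathbb{R}^m)$ given by $$F(x) := f(x) + \frac{1}{N} \, \mathrm{Int} ( \gamma_x) ( Nx_1 ) + \frac{1}{N^2} \, \mathrm{Int}^2 ( \delta_x) ( Nx_1 ) \qquad \forall x =( x_1, \ldots, x_n ) \in E$$ ($N$ a positive integer) satisfies the following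 properties for $N$ sufficiently large: (a) $\|F-f\|_{C^0} <\epsilon$; (b) for every $x\in E$, $J^2_F(x) \in \mathcal{R}_{\epsilon}$.
   Context: For $K\subset\mathbb{R}^{n-d}$, $C^{\infty}_{per,d}(K\times\mathbb{R}^d,\mathbb{R}^m)$ is the set of smooth functions $K\times\mathbb{R}^d\to\mathbb{R}^m$ that are $\mathbb{Z}^d$-periodic in the last $d$ variables; if $K$ is not open, a function on $K\times\mathbb{R}^d$ is called smooth if it extends smoothly to an open neighborhood. With $E=K\times\mathbb{R}^d$, $C^{\infty}_{per,d}(E,\mathbb{R}^m)$ denotes this set. A well-adapted smooth family of loops valued in $\mathbb{R}^m$ is a family $\{\gamma_x:=\gamma(x,\cdot)\}_{x\in E}$ with $\gamma\in C^{\infty}_{per,d+1}(K\times\mathbb{R}^{d+1},\mathbb{R}^m)$ (smooth in $(x,t)$, $\mathbb{Z}^d$-periodic in the last $d$ components of $x$, $1$-periodic in $t$). $\partial_j\gamma_x(t)$ is the derivative in $x_j$ at fixed $t$. For a smooth $1$-periodic loop $\gamma:\mathbb{R}\to\mathbb{R}^m$, $\overline{\gamma}:=\int_0^1\gamma(s)\,ds$, $\mathrm{Int}(\gamma)(t):=\int_0^t(\gamma(s)-\overline{\gamma})\,ds$, and $\mathrm{Int}^2=\mathrm{Int}\circ\mathrm{Int}$. $\|\cdot\|_{C^0}$ is the supremum norm over $E$. Jets: $J^2(E,\mathbb{R}^m)=E\times\mathbb{R}^m\times(\mathbb{R}^m)^n\times(\mathbb{R}^m)^{n(n+1)/2}$,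 whose elements are written $\sigma=(\sigma_0,\sigma^0,\sigma^1_1,\ldots,\sigma^1_n,(\sigma^2_{ij})_{1\le i\le j\le n})$; a partial differential relation is a subset of $J^2(E,\mathbb{R}^m)$; the $2$-jet of $f$ at $x$ is $J^2_f(x)=(x,f(x),(\partial_1f(x),\ldots,\partial_nf(x)),(\partial^2_{ij}f(x))_{1\le i\le j\le n})$. $\check{\sigma}$ is the tuple obtained from $\sigma$ by removing $\sigma_0$, $\sigma^1_1$ and $\sigma^2_{1j}$ for $j=1,\ldots,n$; $\check{J}^2(E,\mathbb{R}^m)$ is the set of all such $\check\sigma$. $\sigma^2_{1*}:=(\sigma^2_{12},\ldots,\sigma^2_{1n})$. A partial differential relation $\mathcal{R}\subset J^2(E,\mathbb{R}^m)$ is semilinear in $x_1$ if there are two smooth maps $L:E\to(\mathbb{R}^m)^*$ and $R:E\times\check{J}^2(E,\mathbb{R}^m)\times\mathbb{R}^m\times(\mathbb{R}^m)^{n-1}\to\mathbb{R}$, both $\mathbb{Z}^d$-periodic in the last $d$ components of the variable $\sigma_0\in E$ (i.e. $L(\sigma_0+(0_{n-d},k))=L(\sigma_0)$ and $R(\sigma_0+(0_{n-d},k),\check\sigma,\sigma^1_1,\sigma^2_{1*})=R(\sigma_0,\check\sigma,\sigma^1_1,\sigma^2_{1*})$ for all $k\in\mathbb{Z}^d$ and all arguments), such that $$\mathcal{R}=\{\sigma\in J^2(E,\mathbb{R}^m)\mid L(\sigma_0)\cdot\sigma^2_{11}+R(\sigma_0,\check\sigma,\sigma^1_1,\sigma^2_{1*})=0\}.$$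 For $\epsilon>0$, the $\epsilon$-thickening of $\mathcal{R}$ is $$\mathcal{R}_\epsilon=\{\sigma\in J^2(E,\mathbb{R}^m)\mid L(\sigma_0)\cdot\sigma^2_{11}+R(\sigma_0,\check\sigma,\sigma^1_1,\sigma^2_{1*})\in(-\epsilon,\epsilon)\}.$$
   Formalization: The formal theorem adds the assumption that partial derivatives at points of E do not depend on the smooth extension chosen (true if K is the closure of its interior or d = n); without it, e.g. K a single point, the 2-jets on E are undefined. *)

theory Defs
  imports "HOL-Analysis.Analysis"
begin

section \<open>Smooth functions on arbitrary sets\<close>

fun Ck_on :: "nat \<Rightarrow> ('a::real_normed_vector) set \<Rightarrow> ('a \<Rightarrow> 'b::real_normed_vector) \<Rightarrow> bool" where
  "Ck_on 0 U g \<longleftrightarrow> continuous_on U g"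
| "Ck_on (Suc k) U g \<longleftrightarrow>
     (\<forall>x\<in>U. g differentiable (at x)) \<and> (\<forall>v. Ck_on k U (\<lambda>x. frechet_derivative g (at x) v))"

definition smooth_extension ::
  "('a::real_normed_vector) set \<Rightarrow> ('a \<Rightarrow> 'b::real_normed_vector) \<Rightarrow> ('a \<Rightarrow> 'b) \<Rightarrow> bool" where
  "smooth_extension S f g \<longleftrightarrow>
     (\<exists>U. open U \<and> S \<subseteq> U \<and> (\<forall>k. Ck_on k U g)) \<and> (\<forall>x\<in>S. g x = f x)"

definition smooth_on :: "('a::real_normed_vector) set \<Rightarrow> ('a \<Rightarrow> 'b::real_normed_vector) \<Rightarrow> bool" where
  "smooth_on S f \<longleftrightarrow> (\<exists>g. smooth_extension S f g)"

text \<open>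
  At a point of \<open>S\<close> the partial derivative of a smooth function on \<open>S\<close> is the partial derivative
  of any of its smooth extensions. It is only meaningful if all extensions give the same
  value; \<open>partials_well_defined\<close> says exactly this. Scalar functions suffice, by
  composing with coordinates, and first order suffices, by iteration.
  The condition holds for all open sets and, more generally, for all \<open>S \<subseteq> closure (interior S)\<close>;
  it fails, e.g., for a single point.
\<close>

definition partial_on ::
  "(real^'n) set \<Rightarrow> 'n::finite \<Rightarrow> (real^'n \<Rightarrow> 'b::real_normed_vector) \<Rightarrow> real^'n \<Rightarrow> 'b" where
  "partial_on S i f x =
     (THE v. \<forall>g. smooth_extension S f g \<longrightarrow> frechet_derivative g (at x) (axis i 1) = v)"

definition partials_well_defined :: "(real^'n::finite) set \<Rightarrow> bool" where
  "partials_well_defined S \<longleftrightarrow>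
     (\<forall>(f :: real^'n \<Rightarrow> real) g h. smooth_extension S f g \<and> smooth_extension S f h \<longrightarrow>
        (\<forall>x\<in>S. \<forall>i. frechet_derivative g (at x) (axis i 1) = frechet_derivative h (at x) (axis i 1)))"

lemma partials_well_defined_regular:
  fixes S :: "(real^'n::finite) set"
  assumes "S \<subseteq> closure (interior S)"
  shows "partials_well_defined S"
  unfolding partials_well_defined_def
proof (intro allI impI ballI)
  fix f g h :: "real^'n \<Rightarrow> real" and x :: "real^'n" and i :: 'n
  assume gh: "smooth_extension S f g \<and> smooth_extension S f h" and x: "x \<in> S"
  obtain U V where U: "open U" "S \<subseteq> U" "\<And>k. Ck_on k U g" and V: "open V" "S \<subseteq> V" "\<And>k. Ck_on k V h"
    and eq: "\<And>y. y \<in> S \<Longrightarrow> g y = h y"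
    using gh unfolding smooth_extension_def by (metis (no_types, lifting))
  define Dg where "Dg = (\<lambda>y. frechet_derivative g (at y) (axis i 1))"
  define Dh where "Dh = (\<lambda>y. frechet_derivative h (at y) (axis i 1))"
  have cont: "continuous_on U Dg" "continuous_on V Dh"
    using U(3)[of "Suc 0"] V(3)[of "Suc 0"] by (auto simp: Dg_def Dh_def)
  have int: "Dg y = Dh y" if y: "y \<in> interior S" for y
  proof -
    have "y \<in> U" using y U(2) interior_subset by blast
    then have "(g has_derivative frechet_derivative g (at y)) (at y)"
      using U(3)[of "Suc 0"] frechet_derivative_works by auto
    then have "(h has_derivative frechet_derivative g (at y)) (at y)"
      by (rule has_derivative_transform_within_open[of _ _ _ _ "interior S"])
        (use y eq interior_subset in auto)
    then show ?thesis
      unfolding Dg_def Dh_def using frechet_derivative_at by metis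
  qed
  obtain s where s: "\<And>n. s n \<in> interior S" "s \<longlonglongrightarrow> x"
    using assms x closure_sequential by blast
  have "isCont Dg x" "isCont Dh x"
    using cont U V x continuous_on_eq_continuous_at by blast+
  then have "(\<lambda>n. Dg (s n)) \<longlonglongrightarrow> Dg x" "(\<lambda>n. Dh (s n)) \<longlonglongrightarrow> Dh x"
    using s(2) isCont_tendsto_compose by blast+
  then have "Dg x = Dh x"
    using int s(1) LIMSEQ_unique by (metis (no_types, lifting) ext)
  then show "frechet_derivative g (at x) (axis i 1) = frechet_derivative h (at x) (axis i 1)"
    by (simp add: Dg_def Dh_def)
qed

section \<open>The domain\<close>

type_synonym 'n rvec = "(real, 'n) vec"
type_synonym ('n, 'm) fam = "('m rvec, 'n) vec"
type_synonym ('n, 'm) mat = "(('m rvec, 'n) vec, 'n) vec"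


text \<open>
  The coordinates of \<open>\<real>\<^sup>n\<close> are indexed by a finite linearly ordered type with \<open>n\<close> elements;
  \<open>fst_ix\<close> plays the role of the index 1. \<open>\<real>\<^sup>n\<^sup>-\<^sup>d\<close> is identified with
  the subspace of \<open>\<real>\<^sup>n\<close> on which the last \<open>d\<close> coordinates vanish, so that \<open>d = 0\<close> and
  \<open>d = n\<close> are allowed.
\<close>

definition fst_ix :: "'n::{finite,linorder}" where
  "fst_ix = Min UNIV"

definition last_ixs :: "nat \<Rightarrow> ('n::{finite,linorder}) set" where
  "last_ixs d = {i. card {j. i \<le> j} \<le> d}"

definition first_space :: "nat \<Rightarrow> 'n::{finite,linorder} rvec set" where
  "first_space d = {y. \<forall>i\<in>last_ixs d. y $ i = 0}"

definition cyl :: "nat \<Rightarrow> 'n::{finite,linorder} rvec set \<Rightarrow> 'n rvec set" where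
  "cyl d K = {x. (\<chi> i. if i \<in> last_ixs d then 0 else x $ i) \<in> K}"

definition lattice_vecs :: "nat \<Rightarrow> 'n::{finite,linorder} rvec set" where
  "lattice_vecs d = {k. \<forall>i. if i \<in> last_ixs d then k $ i \<in> \<int> else k $ i = 0}"

definition Cinf_per :: "nat \<Rightarrow> 'n::{finite,linorder} rvec set \<Rightarrow> ('n rvec \<Rightarrow> 'b::real_normed_vector) set" where
  "Cinf_per d E = {f. smooth_on E f \<and> (\<forall>x\<in>E. \<forall>k\<in>lattice_vecs d. f (x + k) = f x)}"

definition C0_norm :: "'a set \<Rightarrow> ('a \<Rightarrow> 'b::real_normed_vector) \<Rightarrow> ennreal" where
  "C0_norm E f = (SUP x\<in>E. ennreal (norm (f x)))"

section \<open>Loops\<close>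

definition well_adapted ::
  "nat \<Rightarrow> 'n::{finite,linorder} rvec set \<Rightarrow> ('n rvec \<Rightarrow> real \<Rightarrow> 'b::real_normed_vector) \<Rightarrow> bool" where
  "well_adapted d E \<gamma> \<longleftrightarrow>
     smooth_on (E \<times> UNIV) (\<lambda>(x, t). \<gamma> x t) \<and>
     (\<forall>x\<in>E. \<forall>t. \<gamma> x (t + 1) = \<gamma> x t \<and> (\<forall>k\<in>lattice_vecs d. \<gamma> (x + k) t = \<gamma> x t))"

definition loop_mean :: "(real \<Rightarrow> 'm::finite rvec) \<Rightarrow> 'm rvec" where
  "loop_mean g = (LBINT s=0..1. g s)"

definition loop_Int :: "(real \<Rightarrow> 'm::finite rvec) \<Rightarrow> real \<Rightarrow> 'm rvec" where
  "loop_Int g t = (LBINT s=0..t. g s - loop_mean g)"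

section \<open>Jets\<close>

text \<open>
  Families indexed by a subset of the indices (or of the pairs of indices) are encoded
  as full vectors (matrices) that are zero outside of that subset. In particular, a family
  \<open>(\<sigma>\<^sup>2\<^sub>i\<^sub>j)\<close> with \<open>i \<le> j\<close> is an upper triangular matrix, and in \<open>\<sigma>\<^sup>2\<^sub>1\<^sub>*\<close> and in the
  check of a jet the removed entries are zero. Smoothness on such a coordinate subspace,
  in the sense of \<open>smooth_on\<close>, is ordinary smoothness in the remaining coordinates.
\<close>

type_synonym ('n, 'm) jet = "'n rvec \<times> 'm rvec \<times> ('n, 'm) fam \<times> ('n, 'm) mat"
type_synonym ('n, 'm) cjet = "'m rvec \<times> ('n, 'm) fam \<times> ('n, 'm) mat"

definition J2 :: "'n::{finite,linorder} rvec set \<Rightarrow> ('n, 'm::finite) jet set" where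
  "J2 E = {(x, s0, s1, s2). x \<in> E \<and> (\<forall>i j. j < i \<longrightarrow> s2 $ i $ j = 0)}"

definition jet2 ::
  "'n::{finite,linorder} rvec set \<Rightarrow> ('n rvec \<Rightarrow> 'm::finite rvec) \<Rightarrow> 'n rvec \<Rightarrow> ('n, 'm) jet" where
  "jet2 E f x =
     (x, f x, (\<chi> i. partial_on E i f x),
      (\<chi> i j. if i \<le> j then partial_on E i (partial_on E j f) x else 0))"

fun check :: "('n::{finite,linorder}, 'm::finite) jet \<Rightarrow> ('n, 'm) cjet" where
  "check (x, s0, s1, s2) =
     (s0, (\<chi> i. if i = fst_ix then 0 else s1 $ i),
      (\<chi> i j. if i = fst_ix then 0 else s2 $ i $ j))"

definition cJ2 :: "'n::{finite,linorder} rvec set \<Rightarrow> ('n, 'm::finite) cjet set" where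
  "cJ2 E = check ` J2 E"

definition tail :: "('n::{finite,linorder}, 'm::finite) fam \<Rightarrow> ('n, 'm) fam" where
  "tail w = (\<chi> j. if j = fst_ix then 0 else w $ j)"

section \<open>Semilinear relations\<close>

definition R_dom ::
  "'n::{finite,linorder} rvec set \<Rightarrow>
     ('n rvec \<times> ('n, 'm::finite) cjet \<times> 'm rvec \<times> ('n, 'm) fam) set" where
  "R_dom E = E \<times> cJ2 E \<times> UNIV \<times> range tail"

fun semilinear_expr ::
  "('n::{finite,linorder} rvec \<Rightarrow> 'm::finite rvec \<Rightarrow>\<^sub>L real) \<Rightarrow>
   ('n rvec \<times> ('n, 'm) cjet \<times> 'm rvec \<times> ('n, 'm) fam \<Rightarrow> real) \<Rightarrow> ('n, 'm) jet \<Rightarrow> real" where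
  "semilinear_expr L R (x, s0, s1, s2) =
     blinfun_apply (L x) (s2 $ fst_ix $ fst_ix)
     + R (x, check (x, s0, s1, s2), s1 $ fst_ix, tail (s2 $ fst_ix))"

definition semilinear_in_x1 ::
  "nat \<Rightarrow> 'n::{finite,linorder} rvec set \<Rightarrow> ('n, 'm::finite) jet set \<Rightarrow>
   ('n rvec \<Rightarrow> 'm rvec \<Rightarrow>\<^sub>L real) \<Rightarrow>
   ('n rvec \<times> ('n, 'm) cjet \<times> 'm rvec \<times> ('n, 'm) fam \<Rightarrow> real) \<Rightarrow> bool" where
  "semilinear_in_x1 d E Rel L R \<longleftrightarrow>
     L \<in> Cinf_per d E \<and>
     smooth_on (R_dom E) R \<and>
     (\<forall>(x, c, p, w)\<in>R_dom E. \<forall>k\<in>lattice_vecs d. R (x + k, c, p, w) = R (x, c, p, w)) \<and>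
     Rel = {\<sigma> \<in> J2 E. semilinear_expr L R \<sigma> = 0}"

definition thickening ::
  "'n::{finite,linorder} rvec set \<Rightarrow> ('n rvec \<Rightarrow> 'm::finite rvec \<Rightarrow>\<^sub>L real) \<Rightarrow>
   ('n rvec \<times> ('n, 'm) cjet \<times> 'm rvec \<times> ('n, 'm) fam \<Rightarrow> real) \<Rightarrow> real \<Rightarrow> ('n, 'm) jet set" where
  "thickening E L R \<epsilon> = {\<sigma> \<in> J2 E. semilinear_expr L R \<sigma> \<in> {-\<epsilon><..<\<epsilon>}}"

end

theory Submission
  imports Defs
begin

text \<open>
  Write \<open>\<Gamma> = Int \<gamma>\<close> and \<open>\<Delta> = Int\<^sup>2 \<delta>\<close>, so that \<open>\<partial>\<^sub>t\<Gamma> = \<gamma>\<close> and \<open>\<partial>\<^sub>t\<^sup>2\<Delta> = \<delta>\<close>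
  because the means vanish. All derivatives of \<open>\<Gamma>\<close> and \<open>\<Delta>\<close> are periodic, hence bounded, and
  the chain rule at \<open>t = N x\<^sub>1\<close> gives, up to errors \<open>O(1/N)\<close> uniform on \<open>E\<close>,
  \<open>\<partial>\<^sub>1F = \<partial>\<^sub>1f + \<gamma>\<close>, \<open>\<partial>\<^sub>1\<partial>\<^sub>jF = \<partial>\<^sub>1\<partial>\<^sub>jf + \<partial>\<^sub>j\<gamma>\<close> for \<open>j > 1\<close>, and
  \<open>\<partial>\<^sub>1\<^sup>2F = \<partial>\<^sub>1\<^sup>2f + N \<partial>\<^sub>t\<gamma> + 2 \<partial>\<^sub>1\<gamma> + \<delta>\<close>, while the remaining entries of the jet are those of
  \<open>f\<close>. Differentiating \<open>L \<cdot> \<gamma> = 0\<close> in \<open>t\<close> and in \<open>x\<^sub>1\<close> shows that \<open>L\<close> kills the terms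
  \<open>N \<partial>\<^sub>t\<gamma>\<close> and \<open>2 \<partial>\<^sub>1\<gamma>\<close>. Since the arguments of \<open>R\<close> in (L3) run through a compact set
  modulo translations, \<open>R\<close> is uniformly continuous there, and (L3) gives the claim.
\<close>

section \<open>Smooth maps\<close>

lemma Ck_on_subset: "Ck_on k U g \<Longrightarrow> V \<subseteq> U \<Longrightarrow> Ck_on k V g"
proof (induction k arbitrary: g)
  case 0
  then show ?case by (auto intro: continuous_on_subset)
next
  case (Suc k)
  then show ?case by auto
qed

lemma Ck_on_imp_continuous_on: "Ck_on k U g \<Longrightarrow> continuous_on U g"
  by (cases k) (simp_all add: continuous_at_imp_continuous_on differentiable_imp_continuous_within)

lemma Ck_on_SucD: "Ck_on (Suc k) U g \<Longrightarrow> Ck_on k U g"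
proof (induction k arbitrary: g)
  case 0
  then show ?case using Ck_on_imp_continuous_on[of "Suc 0" U g] by simp
next
  case (Suc k)
  then show ?case by (metis Ck_on.simps(2))
qed

lemma Ck_on_has_derivative:
  "Ck_on (Suc k) U g \<Longrightarrow> x \<in> U \<Longrightarrow> (g has_derivative frechet_derivative g (at x)) (at x)"
  using frechet_derivative_works by auto

lemma frechet_derivative_eqI:
  "(f has_derivative f') (at x) \<Longrightarrow> frechet_derivative f (at x) = f'"
  using frechet_derivative_at by metis

text \<open>Openness makes differentiability a local matter. At each point of \<open>U\<close> both
  functions admit the same derivatives, so the choice in \<open>frechet_derivative\<close> gives the
  same map for both.\<close>

lemma Ck_on_cong:
  assumes "open U" "\<And>x. x \<in> U \<Longrightarrow> f x = g x"
  shows "Ck_on k U f \<longleftrightarrow> Ck_on k U g"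
  using assms(2)
proof (induction k arbitrary: f g)
  case 0
  then show ?case by (auto cong: continuous_on_cong)
next
  case (Suc k)
  have D: "(f has_derivative D) (at x) \<longleftrightarrow> (g has_derivative D) (at x)" if "x \<in> U" for D x
    using has_derivative_transform_within_open[of f D x UNIV U g]
      has_derivative_transform_within_open[of g D x UNIV U f] assms(1) that Suc.prems by auto
  then have "frechet_derivative f (at x) v = frechet_derivative g (at x) v" if "x \<in> U" for x v
    using that unfolding frechet_derivative_def by simp
  then have "Ck_on k U (\<lambda>x. frechet_derivative f (at x) v)
      \<longleftrightarrow> Ck_on k U (\<lambda>x. frechet_derivative g (at x) v)" for v
    by (intro Suc.IH)
  then show ?case using D by (auto simp: differentiable_def)
qed

text \<open>Any explicit derivative formula valid on \<open>U\<close> may replace the chosen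
  \<open>frechet_derivative\<close>; this drives the inductions on \<open>k\<close> below.\<close>

lemma Ck_on_SucI:
  assumes "open U" "\<And>x. x \<in> U \<Longrightarrow> (f has_derivative f' x) (at x)" "\<And>v. Ck_on k U (\<lambda>x. f' x v)"
  shows "Ck_on (Suc k) U f"
  unfolding Ck_on.simps
proof (intro conjI ballI allI)
  show "f differentiable at x" if "x \<in> U" for x
    using assms(2)[OF that] differentiable_def by blast
  show "Ck_on k U (\<lambda>x. frechet_derivative f (at x) v)" for v
    using assms(3)[of v] Ck_on_cong[OF assms(1), of "\<lambda>x. f' x v" "\<lambda>x. frechet_derivative f (at x) v" k]
    by (simp add: frechet_derivative_eqI[OF assms(2)])
qed

lemma Ck_on_const: "open U \<Longrightarrow> Ck_on k U (\<lambda>x. c)"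
proof (induction k arbitrary: c)
  case (Suc k)
  show ?case by (rule Ck_on_SucI[OF Suc.prems has_derivative_const]) (rule Suc.IH[OF Suc.prems])
qed auto

lemma Ck_on_bounded_linear: "open U \<Longrightarrow> bounded_linear f \<Longrightarrow> Ck_on k U f"
proof (induction k)
  case 0
  then show ?case by (auto intro: linear_continuous_on)
next
  case (Suc k)
  show ?case
    by (rule Ck_on_SucI[OF Suc.prems(1), of f "\<lambda>_. f"])
      (use Suc.prems in \<open>auto intro: bounded_linear_imp_has_derivative Ck_on_const\<close>)
qed

section \<open>Closure of \<open>Ck_on\<close> under algebraic operations and composition\<close>

lemma Ck_on_add:
  assumes U: "open U" shows "Ck_on k U f \<Longrightarrow> Ck_on k U g \<Longrightarrow> Ck_on k U (\<lambda>x. f x + g x)"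
proof (induction k arbitrary: f g)
  case 0
  then show ?case by (auto intro: continuous_intros)
next
  case (Suc k)
  show ?case
    by (rule Ck_on_SucI[OF U has_derivative_add[OF Ck_on_has_derivative[OF Suc.prems(1)]
            Ck_on_has_derivative[OF Suc.prems(2)]]])
      (use Suc in auto)
qed

text \<open>By the product rule each derivative is a sum of two terms of the same bilinear form, to
  which the induction hypothesis applies after lowering the order of the undifferentiated
  factor.\<close>

lemma (in bounded_bilinear) Ck_on_bilinear:
  assumes U: "open U" shows "Ck_on k U f \<Longrightarrow> Ck_on k U g \<Longrightarrow> Ck_on k U (\<lambda>x. prod (f x) (g x))"
proof (induction k arbitrary: f g)
  case 0
  then show ?case by (auto intro: continuous_on)
next
  case (Suc k)
  show ?case
    by (rule Ck_on_SucI[OF U FDERIV[OF Ck_on_has_derivative[OF Suc.prems(1)]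
            Ck_on_has_derivative[OF Suc.prems(2)]]])
      (use Suc Ck_on_SucD[OF Suc.prems(1)] Ck_on_SucD[OF Suc.prems(2)] in
        \<open>auto intro!: Ck_on_add[OF U] Suc.IH\<close>)
qed

lemma Ck_on_scaleR_const:
  assumes U: "open U" and "Ck_on k U f" shows "Ck_on k U (\<lambda>x. c *\<^sub>R f x)"
  by (rule bounded_bilinear.Ck_on_bilinear[OF bounded_bilinear_scaleR U Ck_on_const[OF U] assms(2)])

lemma Ck_on_linear_compose:
  assumes U: "open U" and \<phi>: "bounded_linear \<phi>"
  shows "Ck_on k U g \<Longrightarrow> Ck_on k U (\<lambda>x. \<phi> (g x))"
proof (induction k arbitrary: g)
  case 0
  then show ?case using bounded_linear.continuous_on[OF \<phi>] by auto
next
  case (Suc k)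
  show ?case
    by (rule Ck_on_SucI[OF U bounded_linear.has_derivative[OF \<phi> Ck_on_has_derivative[OF Suc.prems]]])
      (use Suc in auto)
qed

text \<open>For an affine inner map the derivative in direction \<open>v\<close> is a derivative of
  \<open>g\<close> in the fixed direction \<open>A v\<close>, again composed with the same map, so
  the induction closes.\<close>

lemma Ck_on_compose_affine:
  assumes A: "bounded_linear A" and U: "open U"
  shows "Ck_on k U g \<Longrightarrow> Ck_on k ((\<lambda>x. A x + c) -` U) (\<lambda>x. g (A x + c))"
proof (induction k arbitrary: g)
  case 0
  have "continuous_on ((\<lambda>x. A x + c) -` U) (\<lambda>x. A x + c)"
    by (intro continuous_intros linear_continuous_on A)
  with 0 show ?case using continuous_on_compose2[of U g _ "\<lambda>x. A x + c"] by auto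
next
  case (Suc k)
  have o: "open ((\<lambda>x. A x + c) -` U)"
    by (intro open_vimage U continuous_intros linear_continuous_on A)
  have "((\<lambda>x. A x + c) has_derivative A) (at x)" for x
    using has_derivative_add_const[OF bounded_linear_imp_has_derivative[OF A]] by auto
  from has_derivative_compose[OF this]
  have "((\<lambda>x. g (A x + c)) has_derivative (\<lambda>v. frechet_derivative g (at (A x + c)) (A v))) (at x)"
    if "x \<in> (\<lambda>x. A x + c) -` U" for x
    using Ck_on_has_derivative[OF Suc.prems] that by auto
  then show ?case by (rule Ck_on_SucI[OF o]) (use Suc in auto)
qed

section \<open>Smooth extensions\<close>

lemma smooth_extension_on: "smooth_extension S f g \<Longrightarrow> smooth_on S f"
  by (auto simp: smooth_on_def)

lemma smooth_extensionE:
  assumes "smooth_extension S f g"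
  obtains U where "open U" "S \<subseteq> U" "\<And>k. Ck_on k U g" "\<And>x. x \<in> S \<Longrightarrow> g x = f x"
  using assms unfolding smooth_extension_def by blast

lemma smooth_extensionI:
  assumes "open U" "S \<subseteq> U" "\<And>k. Ck_on k U g" "\<And>x. x \<in> S \<Longrightarrow> g x = f x"
  shows "smooth_extension S f g"
  using assms unfolding smooth_extension_def by blast

lemma smooth_extension_cong:
  "(\<And>x. x \<in> S \<Longrightarrow> f x = f' x) \<Longrightarrow> smooth_extension S f g \<longleftrightarrow> smooth_extension S f' g"
  unfolding smooth_extension_def by auto

lemma smooth_on_cong:
  "(\<And>x. x \<in> S \<Longrightarrow> f x = f' x) \<Longrightarrow> smooth_on S f \<longleftrightarrow> smooth_on S f'"
  unfolding smooth_on_def using smooth_extension_cong[of S f f'] by blast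

lemma smooth_extension_has_derivative:
  assumes "smooth_extension S f g" "x \<in> S"
  shows "(g has_derivative frechet_derivative g (at x)) (at x)"
  using smooth_extensionE[OF assms(1)] Ck_on_has_derivative assms(2) by (metis subsetD)

lemma smooth_extension_frechet_derivative:
  assumes "smooth_extension S f g"
  shows "smooth_extension S (\<lambda>x. frechet_derivative g (at x) v) (\<lambda>x. frechet_derivative g (at x) v)"
proof -
  obtain U where U: "open U" "S \<subseteq> U" "\<And>k. Ck_on k U g"
    using smooth_extensionE[OF assms] by metis
  have "Ck_on k U (\<lambda>x. frechet_derivative g (at x) v)" for k using U(3)[of "Suc k"] by simp
  then show ?thesis using U by (intro smooth_extensionI) auto
qed

lemma smooth_on_imp_continuous_on: "smooth_on S f \<Longrightarrow> continuous_on S f"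
  unfolding smooth_on_def
  by (elim exE smooth_extensionE) (metis Ck_on.simps(1) continuous_on_subset continuous_on_cong)

lemma smooth_on_bounded_linear: "bounded_linear f \<Longrightarrow> smooth_on S f"
  by (rule smooth_extension_on[OF smooth_extensionI[OF open_UNIV]]) (auto intro: Ck_on_bounded_linear)

section \<open>Operations on smooth extensions\<close>

lemma smooth_extension_add:
  assumes "smooth_extension S f f'" "smooth_extension S g g'"
  shows "smooth_extension S (\<lambda>x. f x + g x) (\<lambda>x. f' x + g' x)"
proof -
  obtain U where U: "open U" "S \<subseteq> U" "\<And>k. Ck_on k U f'" "\<And>x. x \<in> S \<Longrightarrow> f' x = f x"
    using smooth_extensionE[OF assms(1)] by metis
  obtain V where V: "open V" "S \<subseteq> V" "\<And>k. Ck_on k V g'" "\<And>x. x \<in> S \<Longrightarrow> g' x = g x"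
    using smooth_extensionE[OF assms(2)] by metis
  have "open (U \<inter> V)" using U V by auto
  moreover have "Ck_on k (U \<inter> V) (\<lambda>x. f' x + g' x)" for k
    by (intro Ck_on_add \<open>open (U \<inter> V)\<close> Ck_on_subset[OF U(3)] Ck_on_subset[OF V(3)]) auto
  ultimately show ?thesis using U V by (intro smooth_extensionI[of "U \<inter> V"]) auto
qed

lemma (in bounded_bilinear) smooth_extension_bilinear:
  assumes "smooth_extension S f f'" "smooth_extension S g g'"
  shows "smooth_extension S (\<lambda>x. prod (f x) (g x)) (\<lambda>x. prod (f' x) (g' x))"
proof -
  obtain U where U: "open U" "S \<subseteq> U" "\<And>k. Ck_on k U f'" "\<And>x. x \<in> S \<Longrightarrow> f' x = f x"
    using smooth_extensionE[OF assms(1)] by metis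
  obtain V where V: "open V" "S \<subseteq> V" "\<And>k. Ck_on k V g'" "\<And>x. x \<in> S \<Longrightarrow> g' x = g x"
    using smooth_extensionE[OF assms(2)] by metis
  have "open (U \<inter> V)" using U V by auto
  moreover have "Ck_on k (U \<inter> V) (\<lambda>x. prod (f' x) (g' x))" for k
    by (intro Ck_on_bilinear \<open>open (U \<inter> V)\<close> Ck_on_subset[OF U(3)] Ck_on_subset[OF V(3)]) auto
  ultimately show ?thesis using U V by (intro smooth_extensionI[of "U \<inter> V"]) auto
qed

lemma smooth_extension_scaleR_const:
  assumes "smooth_extension S f f'"
  shows "smooth_extension S (\<lambda>x. c *\<^sub>R f x) (\<lambda>x. c *\<^sub>R f' x)"
proof -
  have "smooth_extension S (\<lambda>x. c) (\<lambda>x. c)"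
    by (rule smooth_extensionI[OF open_UNIV]) (auto intro: Ck_on_const)
  from bounded_bilinear.smooth_extension_bilinear[OF bounded_bilinear_scaleR this assms]
  show ?thesis .
qed

text \<open>Covers the substitutions made later: lattice translations, slices at fixed time, and the
  graph of \<open>N\<close> times a coordinate.\<close>

lemma smooth_extension_compose_affine:
  assumes "smooth_extension S f g" "bounded_linear A" "\<And>x. x \<in> T \<Longrightarrow> A x + c \<in> S"
  shows "smooth_extension T (\<lambda>x. f (A x + c)) (\<lambda>x. g (A x + c))"
proof -
  obtain U where U: "open U" "S \<subseteq> U" "\<And>k. Ck_on k U g" "\<And>x. x \<in> S \<Longrightarrow> g x = f x"
    using smooth_extensionE[OF assms(1)] by metis
  have "open ((\<lambda>x. A x + c) -` U)"
    by (intro open_vimage U continuous_intros linear_continuous_on assms)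
  with U(1,3) subsetD[OF U(2) assms(3)] U(4)[OF assms(3)] assms(2) show ?thesis
    by (intro smooth_extensionI[of "(\<lambda>x. A x + c) -` U"] Ck_on_compose_affine) auto
qed

lemma smooth_on_add: "smooth_on S f \<Longrightarrow> smooth_on S g \<Longrightarrow> smooth_on S (\<lambda>x. f x + g x)"
  unfolding smooth_on_def using smooth_extension_add by blast

lemma smooth_on_scaleR_const: "smooth_on S f \<Longrightarrow> smooth_on S (\<lambda>x. c *\<^sub>R f x)"
  unfolding smooth_on_def using smooth_extension_scaleR_const by blast

lemma (in bounded_bilinear) smooth_on_bilinear:
  "smooth_on S f \<Longrightarrow> smooth_on S g \<Longrightarrow> smooth_on S (\<lambda>x. prod (f x) (g x))"
  unfolding smooth_on_def using smooth_extension_bilinear by blast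

lemma smooth_on_compose_affine:
  assumes "smooth_on S f" "bounded_linear A" "\<And>x. x \<in> T \<Longrightarrow> A x + c \<in> S"
  shows "smooth_on T (\<lambda>x. f (A x + c))"
  using assms smooth_extension_compose_affine unfolding smooth_on_def by blast

lemma smooth_on_compose_linear:
  assumes "smooth_on S f" "bounded_linear A" "\<And>x. x \<in> T \<Longrightarrow> A x \<in> S"
  shows "smooth_on T (\<lambda>x. f (A x))"
  using smooth_on_compose_affine[of S f A T 0] assms by auto

section \<open>Partial derivatives on a set\<close>

lemma partial_on_cong:
  "(\<And>x. x \<in> S \<Longrightarrow> f x = f' x) \<Longrightarrow> partial_on S i f x = partial_on S i f' x"
  unfolding partial_on_def using smooth_extension_cong[of S f f'] by presburger

text \<open>
  \<open>partials_well_defined\<close> speaks about scalar functions only; a separating family \<open>\<Phi>\<close> of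
  functionals transfers it to vector-valued ones.
\<close>

lemma partial_on_eq_separated:
  fixes f :: "real^'n::finite \<Rightarrow> 'b::real_normed_vector"
  assumes S: "partials_well_defined S" and g: "smooth_extension S f g" and x: "x \<in> S"
    and sep: "\<And>v w :: 'b. (\<And>\<phi> :: 'b \<Rightarrow> real. \<phi> \<in> \<Phi> \<Longrightarrow> \<phi> v = \<phi> w) \<Longrightarrow> v = w"
    and lin: "\<And>\<phi>. \<phi> \<in> \<Phi> \<Longrightarrow> bounded_linear \<phi>"
  shows "partial_on S i f x = frechet_derivative g (at x) (axis i 1)"
proof -
  have *: "frechet_derivative h (at x) (axis i 1) = frechet_derivative g (at x) (axis i 1)"
    if h: "smooth_extension S f h" for h
  proof (rule sep)
    fix \<phi> :: "'b \<Rightarrow> real" assume "\<phi> \<in> \<Phi>"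
    then have \<phi>: "bounded_linear \<phi>" by (rule lin)
    have 1: "smooth_extension S (\<lambda>x. \<phi> (f x)) (\<lambda>x. \<phi> (g x)) \<and>
      frechet_derivative (\<lambda>x. \<phi> (g x)) (at x) = (\<lambda>v. \<phi> (frechet_derivative g (at x) v))"
      if g: "smooth_extension S f g" for g
    proof
      show "frechet_derivative (\<lambda>x. \<phi> (g x)) (at x) = (\<lambda>v. \<phi> (frechet_derivative g (at x) v))"
        by (rule frechet_derivative_eqI[OF bounded_linear.has_derivative[OF \<phi>
              smooth_extension_has_derivative[OF g x]]])
      obtain U where U: "open U" "S \<subseteq> U" "\<And>k. Ck_on k U g" "\<And>x. x \<in> S \<Longrightarrow> g x = f x"
        using smooth_extensionE[OF g] by metis
      show "smooth_extension S (\<lambda>x. \<phi> (f x)) (\<lambda>x. \<phi> (g x))"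
        using U by (intro smooth_extensionI[of U] Ck_on_linear_compose[OF U(1) \<phi> U(3)]) auto
    qed
    show "\<phi> (frechet_derivative h (at x) (axis i 1)) = \<phi> (frechet_derivative g (at x) (axis i 1))"
      using S 1[OF h] 1[OF g] x unfolding partials_well_defined_def by metis
  qed
  show ?thesis
    unfolding partial_on_def
  proof (rule the_equality)
    show "v = frechet_derivative g (at x) (axis i 1)"
      if "\<forall>g. smooth_extension S f g \<longrightarrow> frechet_derivative g (at x) (axis i 1) = v" for v
      using that g by simp
  qed (use * in simp)
qed

lemma partial_on_eq:
  fixes f :: "real^'n::finite \<Rightarrow> 'b::euclidean_space"
  assumes "partials_well_defined S" "smooth_extension S f g" "x \<in> S"
  shows "partial_on S i f x = frechet_derivative g (at x) (axis i 1)"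
  by (rule partial_on_eq_separated[OF assms, where \<Phi> = "range (\<lambda>b v. v \<bullet> b)"])
    (auto intro!: bounded_linear_inner_left intro: euclidean_eqI)

text \<open>Evaluations at vectors separate operators. This case is for the partial derivative of
  \<open>L\<close>.\<close>

lemma partial_on_eq_blinfun:
  fixes f :: "real^'n::finite \<Rightarrow> 'b::real_normed_vector \<Rightarrow>\<^sub>L real"
  assumes "partials_well_defined S" "smooth_extension S f g" "x \<in> S"
  shows "partial_on S i f x = frechet_derivative g (at x) (axis i 1)"
  by (rule partial_on_eq_separated[OF assms, where \<Phi> = "range (\<lambda>v T. blinfun_apply T v)"])
    (auto intro!: blinfun.bounded_linear_left intro: blinfun_eqI)

lemma partial_on_const:
  fixes c :: "'b::euclidean_space"
  assumes "partials_well_defined S" "x \<in> S"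
  shows "partial_on S i (\<lambda>x. c) x = 0"
proof -
  have "smooth_extension S (\<lambda>x. c) (\<lambda>x. c)"
    by (rule smooth_extensionI[OF open_UNIV]) (auto intro: Ck_on_const)
  from partial_on_eq[OF assms(1) this assms(2)] show ?thesis by simp
qed

text \<open>The derivative of an extension extends the partial derivative, so
  \<open>partial_on\<close> can be iterated.\<close>

lemma smooth_on_partial_on:
  fixes f :: "real^'n::finite \<Rightarrow> 'b::euclidean_space"
  assumes "partials_well_defined S" "smooth_on S f"
  shows "smooth_on S (partial_on S i f)"
proof -
  obtain g where g: "smooth_extension S f g" using assms smooth_on_def by blast
  have "smooth_on S (\<lambda>x. frechet_derivative g (at x) (axis i 1))"
    by (rule smooth_extension_on[OF smooth_extension_frechet_derivative[OF g]])
  then show ?thesis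
    using partial_on_eq[OF assms(1) g] smooth_on_cong by (metis (no_types, lifting))
qed

lemma partial_on_add:
  fixes f g :: "real^'n::finite \<Rightarrow> 'b::euclidean_space"
  assumes S: "partials_well_defined S" "x \<in> S" and f: "smooth_on S f" and g: "smooth_on S g"
  shows "partial_on S i (\<lambda>x. f x + g x) x = partial_on S i f x + partial_on S i g x"
proof -
  obtain f' where f': "smooth_extension S f f'" using f smooth_on_def by blast
  obtain g' where g': "smooth_extension S g g'" using g smooth_on_def by blast
  note has_derivative_add[OF smooth_extension_has_derivative[OF f' S(2)]
      smooth_extension_has_derivative[OF g' S(2)]]
  from frechet_derivative_eqI[OF this] show ?thesis
    by (simp add: partial_on_eq[OF S(1) f' S(2)] partial_on_eq[OF S(1) g' S(2)]
        partial_on_eq[OF S(1) smooth_extension_add[OF f' g'] S(2)])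
qed

lemma partial_on_scaleR:
  fixes f :: "real^'n::finite \<Rightarrow> 'b::euclidean_space"
  assumes S: "partials_well_defined S" "x \<in> S" and f: "smooth_on S f"
  shows "partial_on S i (\<lambda>x. c *\<^sub>R f x) x = c *\<^sub>R partial_on S i f x"
proof -
  obtain f' where f': "smooth_extension S f f'" using f smooth_on_def by blast
  note has_derivative_scaleR_right[OF smooth_extension_has_derivative[OF f' S(2)]]
  from frechet_derivative_eqI[OF this] show ?thesis
    by (simp add: partial_on_eq[OF S(1) f' S(2)]
        partial_on_eq[OF S(1) smooth_extension_scaleR_const[OF f'] S(2)])
qed

section \<open>Primitives in the last variable\<close>

text \<open>
  The integral of \<open>g (x, \<cdot>)\<close> over \<open>[0, t]\<close>, rescaled to a fixed interval so that it can be
  differentiated under the integral sign. It makes sense where the whole segment from \<open>(x, 0)\<close> to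
  \<open>(x, t)\<close> lies in the domain \<open>U\<close> of \<open>g\<close>.
\<close>

definition vdom :: "('a::euclidean_space \<times> real) set \<Rightarrow> ('a \<times> real) set" where
  "vdom U = {p. \<forall>s\<in>{0..1}. (fst p, s * snd p) \<in> U}"

definition vint :: "('a::euclidean_space \<times> real \<Rightarrow> 'b::euclidean_space) \<Rightarrow> 'a \<times> real \<Rightarrow> 'b" where
  "vint g p = integral {0..1} (\<lambda>s. snd p *\<^sub>R g (fst p, s * snd p))"

text \<open>The tube lemma applies because the scaling parameter runs through the compact interval
  \<open>{0..1}\<close>.\<close>

lemma open_vdom:
  assumes U: "open U"
  shows "open (vdom U)"
proof (rule Topological_Spaces.openI)
  fix p assume p: "p \<in> vdom U"
  define W where "W = (\<lambda>q. (fst (fst q), snd q * snd (fst q))) -` U"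
  have "open W" unfolding W_def by (intro open_vimage U continuous_intros)
  moreover have "{p} \<times> {0..1} \<subseteq> W" using p by (auto simp: vdom_def W_def)
  ultimately obtain X where X: "p \<in> X" "open X" "X \<times> {0..1} \<subseteq> W"
    using Elementary_Topology.tube_lemma[of "{0..1::real}" W p] by auto
  have "X \<subseteq> vdom U" using X(3) by (fastforce simp: vdom_def W_def)
  then show "\<exists>T. open T \<and> p \<in> T \<and> T \<subseteq> vdom U" using X by blast
qed

lemma vdom_subset: "vdom U \<subseteq> U"
  by (auto simp: vdom_def dest: bspec[of _ _ 1])

lemma vdom_contract: "p \<in> vdom U \<Longrightarrow> s \<in> {0..1} \<Longrightarrow> (fst p, s * snd p) \<in> U"
  by (auto simp: vdom_def)

lemma continuous_on_vdom:
  assumes "continuous_on U g" "V \<subseteq> vdom U"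
  shows "continuous_on (V \<times> {0..1}) (\<lambda>(p, s). g (fst p, s * snd p))"
  unfolding split_beta
  by (rule continuous_on_compose2[OF assms(1)])
    (use assms(2) in \<open>auto simp: vdom_def intro!: continuous_intros\<close>)

lemma continuous_on_vdom_slice:
  assumes "continuous_on U g" "p \<in> vdom U"
  shows "continuous_on {0..1} (\<lambda>s. g (fst p, s * snd p))"
  by (rule continuous_on_compose2[OF assms(1)])
    (use assms(2) in \<open>auto simp: vdom_def intro!: continuous_intros\<close>)

lemma continuous_on_vint:
  assumes "continuous_on U g"
  shows "continuous_on (vdom U) (vint g)"
proof -
  have "continuous_on (vdom U \<times> cbox 0 1) (\<lambda>(p, s). snd p *\<^sub>R g (fst p, s * snd p))"
    using continuous_on_vdom[OF assms order_refl] unfolding split_beta cbox_interval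
    by (intro continuous_intros) auto
  from integral_continuous_on_param[OF this] show ?thesis
    by (simp add: vint_def[abs_def] cbox_interval)
qed

text \<open>
  The derivative is again of the form \<open>vint\<close> plus a multiple of \<open>g\<close>, as the \<open>t\<close>-derivatives
  integrate to \<open>g p\<close>; this lets \<open>vint\<close> preserve \<open>Ck_on k\<close> by induction on \<open>k\<close>.
\<close>

lemma vint_has_derivative:
  fixes g :: "'a::euclidean_space \<times> real \<Rightarrow> 'b::euclidean_space"
  assumes U: "open U" and g: "Ck_on (Suc 0) U g" and p: "p \<in> vdom U"
  shows "(vint g has_derivative
    (\<lambda>v. vint (\<lambda>q. frechet_derivative g (at q) (fst v, 0)) p + snd v *\<^sub>R g p)) (at p)"
proof -
  define D where "D = (\<lambda>q. frechet_derivative g (at q))"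
  have D: "(g has_derivative D q) (at q)" if "q \<in> U" for q
    using Ck_on_has_derivative[OF g that] by (simp add: D_def)
  have Dlin: "bounded_linear (D q)" if "q \<in> U" for q
    using D[OF that] has_derivative_bounded_linear by blast
  have Dc: "continuous_on U (\<lambda>q. D q v)" for v
    using g unfolding D_def Ck_on.simps by blast
  have gc: "continuous_on U g" using g Ck_on_imp_continuous_on by blast
  obtain e where e: "e > 0" "ball p e \<subseteq> vdom U"
    using open_vdom[OF U] p open_contains_ball by blast
  define B where "B = ball p e"
  have B: "B \<subseteq> vdom U" "p \<in> B" "open B" "convex B" using e by (auto simp: B_def)
  define f where "f = (\<lambda>p s. snd p *\<^sub>R g (fst p, s * snd p))"
  define f' where "f' = (\<lambda>p s v. snd v *\<^sub>R g (fst p, s * snd p)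
      + snd p *\<^sub>R D (fst p, s * snd p) (fst v, s * snd v))"
  have f': "((\<lambda>p. f p s) has_derivative f' q s) (at q)" if "q \<in> vdom U" "s \<in> {0..1}" for q s
  proof -
    have 1: "((\<lambda>q. (fst q, s * snd q)) has_derivative (\<lambda>v. (fst v, s * snd v))) (at q)"
      by (auto intro!: derivative_eq_intros)
    from has_derivative_compose[OF 1 D[OF vdom_contract[OF that]]]
    have 2: "((\<lambda>q. g (fst q, s * snd q)) has_derivative
      (\<lambda>v. D (fst q, s * snd q) (fst v, s * snd v))) (at q)" .
    have "(snd has_derivative snd) (at q)"
      by (rule bounded_linear_imp_has_derivative[OF bounded_linear_snd])
    from has_derivative_scaleR[OF this 2]
    show ?thesis unfolding f_def f'_def by (simp add: add.commute)
  qed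
  \<comment> \<open>The Leibniz rule takes operator-valued derivatives. The packaging by
    \<open>Blinfun\<close> is faithful only for points of \<open>vdom U\<close> and \<open>s\<close>
    in \<open>{0..1}\<close>, where \<open>f' q s\<close> is bounded linear.\<close>
  define fx where "fx = (\<lambda>q s. Blinfun (f' q s))"
  have fx: "blinfun_apply (fx q s) = f' q s" if "q \<in> vdom U" "s \<in> {0..1}" for q s
    using f'[OF that] has_derivative_bounded_linear unfolding fx_def
    by (intro bounded_linear_Blinfun_apply) blast
  \<comment> \<open>Splitting the direction into its space and time parts leaves only derivatives of
    \<open>g\<close> in directions independent of \<open>q\<close> and \<open>s\<close>, whose
    continuity is known.\<close>
  have f'_alt: "f' q s v = snd v *\<^sub>R g (fst q, s * snd q)
      + snd q *\<^sub>R (D (fst q, s * snd q) (fst v, 0) + (s * snd v) *\<^sub>R D (fst q, s * snd q) (0, 1))"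
    if "q \<in> vdom U" "s \<in> {0..1}" for q s v
  proof -
    interpret b: bounded_linear "D (fst q, s * snd q)"
      by (rule Dlin vdom_contract that)+
    have "(fst v, s * snd v) = (fst v, 0) + (s * snd v) *\<^sub>R (0, 1)" by simp
    then have "D (fst q, s * snd q) (fst v, s * snd v)
      = D (fst q, s * snd q) (fst v, 0) + (s * snd v) *\<^sub>R D (fst q, s * snd q) (0, 1)"
      by (metis b.add b.scaleR)
    then show ?thesis by (simp add: f'_def)
  qed
  have cont: "continuous_on (B \<times> cbox 0 1) (\<lambda>(q, s). fx q s)"
    unfolding split_beta
  proof (rule continuous_on_blinfun_componentwise)
    fix v :: "'a \<times> real"
    have "continuous_on (B \<times> cbox 0 1) (\<lambda>x. snd v *\<^sub>R g (fst (fst x), snd x * snd (fst x))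
      + snd (fst x) *\<^sub>R (D (fst (fst x), snd x * snd (fst x)) (fst v, 0)
        + (snd x * snd v) *\<^sub>R D (fst (fst x), snd x * snd (fst x)) (0, 1)))"
      using continuous_on_vdom[OF gc B(1)] continuous_on_vdom[OF Dc B(1)]
      unfolding split_beta cbox_interval
      by (intro continuous_intros) auto
    then show "continuous_on (B \<times> cbox 0 1) (\<lambda>x. blinfun_apply (fx (fst x) (snd x)) v)"
    proof (rule continuous_on_eq)
      fix x :: "('a \<times> real) \<times> real" assume "x \<in> B \<times> cbox 0 1"
      then have "fst x \<in> vdom U" "snd x \<in> {0..1}" using B(1) by auto
      then show "snd v *\<^sub>R g (fst (fst x), snd x * snd (fst x))
        + snd (fst x) *\<^sub>R (D (fst (fst x), snd x * snd (fst x)) (fst v, 0)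
          + (snd x * snd v) *\<^sub>R D (fst (fst x), snd x * snd (fst x)) (0, 1))
        = blinfun_apply (fx (fst x) (snd x)) v"
        by (simp only: fx f'_alt)
    qed
  qed
  have "((\<lambda>q. integral (cbox 0 1) (f q)) has_derivative integral (cbox 0 1) (fx p)) (at p within B)"
  proof (rule leibniz_rule[OF _ _ cont B(2,4)])
    show "((\<lambda>q. f q s) has_derivative fx q s) (at q within B)" if "q \<in> B" "s \<in> cbox 0 1" for q s
      using f'[of q s] fx[of q s] that B(1) has_derivative_at_withinI by fastforce
    show "f q integrable_on cbox 0 1" if "q \<in> B" for q
      unfolding f_def cbox_interval using that B(1) continuous_on_vdom_slice[OF gc]
      by (intro integrable_continuous_interval continuous_intros) auto
  qed
  then have 1: "(vint g has_derivative integral {0..1} (fx p)) (at p)"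
    using at_within_open[OF B(2,3)] by (simp add: vint_def[abs_def] f_def cbox_interval)
  have int_fx: "fx p integrable_on {0..1}"
  proof (rule integrable_continuous_interval)
    have "continuous_on {0..1} (\<lambda>s. (p, s))" by (intro continuous_intros)
    from continuous_on_compose2[OF cont this] B(2)
    show "continuous_on {0..1} (fx p)" by auto
  qed
  have "integral {0..1} (fx p) v = vint (\<lambda>q. D q (fst v, 0)) p + snd v *\<^sub>R g p" for v
  proof -
    have c1: "continuous_on {0..1} (\<lambda>s. snd p *\<^sub>R D (fst p, s * snd p) (fst v, 0))"
      by (intro continuous_intros continuous_on_vdom_slice[OF Dc p])
    \<comment> \<open>The terms of \<open>f'_alt\<close> containing \<open>snd v\<close> form the
      \<open>s\<close>-derivative of \<open>s\<close> times \<open>g (fst p, s * snd p)\<close>, up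
      to the factor \<open>snd v\<close>. The boundary value at \<open>0\<close> vanishes and the
      one at \<open>1\<close> is \<open>g p\<close>.\<close>
    have "((\<lambda>s. snd v *\<^sub>R (s *\<^sub>R g (fst p, s * snd p))) has_vector_derivative
      snd v *\<^sub>R (g (fst p, s * snd p) + (s * snd p) *\<^sub>R D (fst p, s * snd p) (0, 1)))
        (at s within {0..1})"
      if s: "s \<in> {0..1}" for s
    proof -
      interpret b: bounded_linear "D (fst p, s * snd p)"
        by (rule Dlin vdom_contract p s)+
      have 1: "((\<lambda>s. (fst p, s * snd p)) has_derivative (\<lambda>h. (0, h * snd p))) (at s within {0..1})"
        by (auto intro!: derivative_eq_intros)
      have eq: "D (fst p, s * snd p) (0, h * snd p)
          = (h * snd p) *\<^sub>R D (fst p, s * snd p) (0, 1)" for h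
        using b.scaleR[of "h * snd p" "(0, 1)"] by simp
      from has_derivative_compose[OF 1 D[OF vdom_contract[OF p s]]]
      have "((\<lambda>s. g (fst p, s * snd p)) has_derivative
          (\<lambda>h. (h * snd p) *\<^sub>R D (fst p, s * snd p) (0, 1))) (at s within {0..1})"
        by (simp add: eq)
      then have "((\<lambda>s. g (fst p, s * snd p)) has_vector_derivative
          snd p *\<^sub>R D (fst p, s * snd p) (0, 1)) (at s within {0..1})"
        by (simp add: has_vector_derivative_def)
      from has_vector_derivative_scaleR[OF DERIV_ident this]
      have "((\<lambda>s. s *\<^sub>R g (fst p, s * snd p)) has_vector_derivative
         g (fst p, s * snd p) + (s * snd p) *\<^sub>R D (fst p, s * snd p) (0, 1)) (at s within {0..1})"
        by (simp add: add.commute)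
      from has_vector_derivative_scaleR[OF DERIV_const[of "snd v"] this] show ?thesis by simp
    qed
    from fundamental_theorem_of_calculus[OF _ this]
    have "((\<lambda>s. snd v *\<^sub>R (g (fst p, s * snd p) + (s * snd p) *\<^sub>R D (fst p, s * snd p) (0, 1)))
      has_integral snd v *\<^sub>R g p) {0..1}"
      by simp
    from has_integral_add[OF integrable_integral[OF integrable_continuous_interval[OF c1]] this]
    have "((\<lambda>s. blinfun_apply (fx p s) v) has_integral
      vint (\<lambda>q. D q (fst v, 0)) p + snd v *\<^sub>R g p) {0..1}"
      unfolding vint_def
      by (rule has_integral_eq[rotated]) (simp add: fx f'_alt p algebra_simps)
    then show ?thesis using blinfun_apply_integral[OF int_fx] by (simp add: integral_unique)
  qed
  then show ?thesis using 1 unfolding D_def by presburger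
qed

lemma Ck_on_vint:
  fixes g :: "'a::euclidean_space \<times> real \<Rightarrow> 'b::euclidean_space"
  assumes U: "open U" shows "Ck_on k U g \<Longrightarrow> Ck_on k (vdom U) (vint g)"
proof (induction k arbitrary: g)
  case 0
  then show ?case by (simp add: continuous_on_vint)
next
  case (Suc k)
  have o: "open (vdom U)" by (rule open_vdom[OF U])
  have "Ck_on (Suc 0) U g"
    using Suc.prems Ck_on_imp_continuous_on unfolding Ck_on.simps by blast
  then show ?case
  proof (rule Ck_on_SucI[OF o vint_has_derivative[OF U]])
    fix v :: "'a \<times> real"
    have "Ck_on k U (\<lambda>q. frechet_derivative g (at q) (fst v, 0))"
      using Suc.prems by simp
    then show "Ck_on k (vdom U) (\<lambda>p. vint (\<lambda>q. frechet_derivative g (at q) (fst v, 0)) p + snd v *\<^sub>R g p)"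
      using Suc.IH Ck_on_subset[OF Ck_on_SucD[OF Suc.prems] vdom_subset]
      by (intro Ck_on_add[OF o] Ck_on_scaleR_const[OF o])
  qed
qed

text \<open>Since \<open>E \<times> UNIV\<close> contains the whole time line over each point of
  \<open>E\<close>, it stays inside \<open>vdom U\<close>.\<close>

lemma smooth_extension_vint:
  fixes h :: "'a::euclidean_space \<Rightarrow> real \<Rightarrow> 'b::euclidean_space"
  assumes "smooth_extension (E \<times> UNIV) (\<lambda>(x, t). h x t) g"
  shows "smooth_extension (E \<times> UNIV) (vint g) (vint g)"
    and "p \<in> E \<times> UNIV \<Longrightarrow> (vint g has_derivative
      (\<lambda>v. vint (\<lambda>q. frechet_derivative g (at q) (fst v, 0)) p + snd v *\<^sub>R g p)) (at p)"
proof -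
  obtain U where U: "open U" "E \<times> UNIV \<subseteq> U" "\<And>k. Ck_on k U g"
    using smooth_extensionE[OF assms] by metis
  have sub: "E \<times> UNIV \<subseteq> vdom U" using U(2) by (auto simp: vdom_def)
  show "smooth_extension (E \<times> UNIV) (vint g) (vint g)"
    by (rule smooth_extensionI[OF open_vdom[OF U(1)] sub Ck_on_vint[OF U(1,3)]]) simp
  show "p \<in> E \<times> UNIV \<Longrightarrow> (vint g has_derivative
      (\<lambda>v. vint (\<lambda>q. frechet_derivative g (at q) (fst v, 0)) p + snd v *\<^sub>R g p)) (at p)"
    using vint_has_derivative[OF U(1,3)] sub by auto
qed

lemma has_vector_derivative_snd:
  assumes "(g has_derivative D) (at (x, t))"
  shows "((\<lambda>s. g (x, s)) has_vector_derivative D (0, 1)) (at t)"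
proof -
  interpret b: bounded_linear D using assms has_derivative_bounded_linear by blast
  have 1: "((\<lambda>s. (x, s)) has_derivative (\<lambda>h. (0, h))) (at t)"
    by (auto intro!: derivative_eq_intros)
  have "(\<lambda>h. D (0, h)) = (\<lambda>h. h *\<^sub>R D (0, 1))"
    by (simp flip: b.scaleR)
  with has_derivative_compose[OF 1 assms] show ?thesis
    by (simp only: has_vector_derivative_def)
qed

text \<open>Both sides are primitives of \<open>h x\<close> vanishing at time \<open>0\<close>. In
  the pure time direction the integral term of the derivative of \<open>vint g\<close> is zero,
  leaving \<open>g\<close> itself.\<close>

lemma interval_integral_eq_vint:
  fixes h :: "'a::euclidean_space \<Rightarrow> real \<Rightarrow> 'm::finite rvec"
  assumes g: "smooth_extension (E \<times> UNIV) (\<lambda>(x, t). h x t) g" and x: "x \<in> E"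
  shows "(LBINT s=0..t. h x s) = vint g (x, t)"
proof -
  have hg: "h x s = g (x, s)" for s using g x by (simp add: smooth_extension_def)
  have "continuous_on UNIV (h x)"
  proof -
    have 1: "continuous_on (E \<times> UNIV) (\<lambda>(x, t). h x t)"
      by (rule smooth_on_imp_continuous_on[OF smooth_extension_on[OF g]])
    have 2: "continuous_on UNIV (\<lambda>s::real. (x, s))" by (intro continuous_intros)
    from continuous_on_compose2[OF 1 2] x show ?thesis by auto
  qed
  moreover have "((\<lambda>s. vint g (x, s)) has_vector_derivative h x s) (at s)" for s
  proof -
    have "bounded_linear (frechet_derivative g (at q))" if "q \<in> E \<times> UNIV" for q
      using smooth_extension_has_derivative[OF g that] has_derivative_bounded_linear by blast
    then have "vint (\<lambda>q. frechet_derivative g (at q) (0, 0)) (x, s) = 0"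
      using x linear_simps(3) unfolding vint_def
      by (subst integral_cong[where g = "\<lambda>_. 0"]) (auto simp flip: zero_prod_def)
    then show ?thesis
      using has_vector_derivative_snd[OF smooth_extension_vint(2)[OF g, of "(x, s)"]] x
      by (simp add: hg)
  qed
  ultimately have "(LBINT s=ereal 0..ereal t. h x s) = vint g (x, t) - vint g (x, 0)"
    by (intro interval_integral_FTC_finite)
      (auto intro: continuous_on_subset has_vector_derivative_at_within)
  then show ?thesis by (simp add: zero_ereal_def vint_def)
qed

lemma loop_mean_eq_vint:
  fixes h :: "'a::euclidean_space \<Rightarrow> real \<Rightarrow> 'm::finite rvec"
  assumes "smooth_extension (E \<times> UNIV) (\<lambda>(x, t). h x t) g" "x \<in> E"
  shows "loop_mean (h x) = vint g (x, 1)"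
  using interval_integral_eq_vint[OF assms, of 1] by (simp add: loop_mean_def one_ereal_def)

text \<open>Splitting off the mean as a term linear in \<open>t\<close> reduces
  \<open>loop_Int\<close> to plain primitives, hence to \<open>vint\<close>.\<close>

lemma loop_Int_eq:
  fixes h :: "real \<Rightarrow> 'm::finite rvec"
  assumes "continuous_on UNIV h"
  shows "loop_Int h t = (LBINT s=0..t. h s) - t *\<^sub>R loop_mean h"
proof -
  have "interval_lebesgue_integrable lborel (ereal 0) (ereal t) h"
    using assms continuous_on_eq_continuous_at[OF open_UNIV] by (intro interval_integrable_isCont) auto
  moreover have "interval_lebesgue_integrable lborel (ereal 0) (ereal t) (\<lambda>s. loop_mean h)"
    by (intro interval_integrable_isCont) auto
  moreover have "(LBINT s=ereal 0..ereal t. loop_mean h) = t *\<^sub>R loop_mean h - 0 *\<^sub>R loop_mean h"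
    by (intro interval_integral_FTC_finite) (auto intro!: derivative_eq_intros)
  ultimately show ?thesis
    unfolding loop_Int_def
    using interval_lebesgue_integral_diff(2)[of lborel "ereal 0" "ereal t" h "\<lambda>s. loop_mean h"]
    by (simp add: zero_ereal_def)
qed

section \<open>Smooth families of loops\<close>

definition pd :: "'n::{finite,linorder} rvec set \<Rightarrow> 'n \<Rightarrow> ('n rvec \<Rightarrow> real \<Rightarrow> 'b::real_normed_vector) \<Rightarrow>
    'n rvec \<Rightarrow> real \<Rightarrow> 'b" where
  "pd E j h x t = partial_on E j (\<lambda>y. h y t) x"

text \<open>Time is unrestricted, so an ordinary derivative suffices here, whereas \<open>pd\<close>
  must use \<open>partial_on\<close> because the space variable only ranges over
  \<open>E\<close>.\<close>

definition td :: "('n::{finite,linorder} rvec \<Rightarrow> real \<Rightarrow> 'b::real_normed_vector) \<Rightarrow> 'n rvec \<Rightarrow> real \<Rightarrow> 'b" where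
  "td h x t = vector_derivative (h x) (at t)"

abbreviation smooth_family ::
  "'n::{finite,linorder} rvec set \<Rightarrow> ('n rvec \<Rightarrow> real \<Rightarrow> 'b::real_normed_vector) \<Rightarrow> bool" where
  "smooth_family E h \<equiv> smooth_on (E \<times> UNIV) (\<lambda>(x, t). h x t)"

abbreviation family_extension ::
  "'n::{finite,linorder} rvec set \<Rightarrow> ('n rvec \<Rightarrow> real \<Rightarrow> 'b::real_normed_vector) \<Rightarrow>
    ('n rvec \<times> real \<Rightarrow> 'b) \<Rightarrow> bool" where
  "family_extension E h g \<equiv> smooth_extension (E \<times> UNIV) (\<lambda>(x, t). h x t) g"

lemma family_extension_eq: "family_extension E h g \<Longrightarrow> x \<in> E \<Longrightarrow> h x t = g (x, t)"
  by (simp add: smooth_extension_def)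

lemma smooth_family_continuous:
  assumes "smooth_family E h" "x \<in> E"
  shows "continuous_on UNIV (h x)"
proof -
  have 2: "continuous_on UNIV (\<lambda>s::real. (x, s))" by (intro continuous_intros)
  from continuous_on_compose2[OF smooth_on_imp_continuous_on[OF assms(1)] 2] assms(2)
  show ?thesis by auto
qed

lemma smooth_extension_slice:
  assumes "family_extension E h g"
  shows "smooth_extension E (\<lambda>y. h y t) (\<lambda>y. g (y, t))"
proof -
  have A: "bounded_linear (\<lambda>y. (y, 0::real))"
    by (intro bounded_linear_Pair bounded_linear_ident bounded_linear_zero)
  from smooth_extension_compose_affine[OF assms this, of E "(0, t)"]
  show ?thesis by simp
qed

lemma smooth_on_slice: "smooth_family E h \<Longrightarrow> smooth_on E (\<lambda>y. h y t)"
  unfolding smooth_on_def using smooth_extension_slice by blast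

text \<open>A slice of an extension on \<open>E \<times> UNIV\<close> is an extension on
  \<open>E\<close>, so well-defined partials on \<open>E\<close> alone determine \<open>pd\<close>
  from \<open>g\<close>.\<close>

lemma pd_eq:
  fixes h :: "'n::{finite,linorder} rvec \<Rightarrow> real \<Rightarrow> 'b::euclidean_space"
  assumes E: "partials_well_defined E" and g: "family_extension E h g" and x: "x \<in> E"
  shows "pd E j h x t = frechet_derivative g (at (x, t)) (axis j 1, 0)"
proof -
  have 1: "((\<lambda>y. (y, t)) has_derivative (\<lambda>v. (v, 0))) (at x)"
    by (auto intro!: derivative_eq_intros)
  have "(g has_derivative frechet_derivative g (at (x, t))) (at (x, t))"
    using smooth_extension_has_derivative[OF g] x by auto
  from frechet_derivative_eqI[OF has_derivative_compose[OF 1 this]] show ?thesis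
    by (simp add: pd_def partial_on_eq[OF E smooth_extension_slice[OF g] x])
qed

lemma has_vector_derivative_td:
  assumes g: "family_extension E h g" and x: "x \<in> E"
  shows "(h x has_vector_derivative td h x t) (at t)"
    and "td h x t = frechet_derivative g (at (x, t)) (0, 1)"
proof -
  have "(g has_derivative frechet_derivative g (at (x, t))) (at (x, t))"
    using smooth_extension_has_derivative[OF g] x by auto
  from has_vector_derivative_snd[OF this]
  have 1: "(h x has_vector_derivative frechet_derivative g (at (x, t)) (0, 1)) (at t)"
    by (simp flip: family_extension_eq[OF g x])
  show 2: "td h x t = frechet_derivative g (at (x, t)) (0, 1)"
    unfolding td_def by (rule vector_derivative_at[OF 1])
  show "(h x has_vector_derivative td h x t) (at t)"
    using 1 2 by simp
qed

lemma family_extension_pd: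
  fixes h :: "'n::{finite,linorder} rvec \<Rightarrow> real \<Rightarrow> 'b::euclidean_space"
  assumes E: "partials_well_defined E" and g: "family_extension E h g"
  shows "family_extension E (pd E j h) (\<lambda>q. frechet_derivative g (at q) (axis j 1, 0))"
  using smooth_extension_frechet_derivative[OF g, of "(axis j 1, 0)"]
  by (rule iffD1[OF smooth_extension_cong, rotated]) (auto simp: pd_eq[OF E g])

lemma smooth_family_pd:
  fixes h :: "'n::{finite,linorder} rvec \<Rightarrow> real \<Rightarrow> 'b::euclidean_space"
  shows "partials_well_defined E \<Longrightarrow> smooth_family E h \<Longrightarrow> smooth_family E (pd E j h)"
  using family_extension_pd unfolding smooth_on_def by blast

lemma smooth_family_td:
  assumes "smooth_family E h"
  shows "smooth_family E (td h)"
proof -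
  obtain g where g: "family_extension E h g" using assms smooth_on_def by blast
  have "family_extension E (td h) (\<lambda>q. frechet_derivative g (at q) (0, 1))"
    using smooth_extension_frechet_derivative[OF g, of "(0, 1)"]
    by (rule iffD1[OF smooth_extension_cong, rotated]) (auto simp: has_vector_derivative_td(2)[OF g])
  then show ?thesis using smooth_on_def by blast
qed

lemma smooth_on_graph:
  assumes "smooth_family E h"
  shows "smooth_on E (\<lambda>x. h x (c * x $ i))"
proof -
  have "bounded_linear (\<lambda>x. (x, c * x $ i))"
    by (intro bounded_linear_Pair bounded_linear_ident bounded_linear_const_mult bounded_linear_vec_nth)
  from smooth_on_compose_linear[OF assms this, of E] show ?thesis by simp
qed

text \<open>Chain rule along \<open>x\<close> mapped to \<open>(x, c * x $ i)\<close>: moving in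
  direction \<open>j\<close> advances time, at speed \<open>c\<close>, only if \<open>j = i\<close>.
  With \<open>c = real N\<close> this is the source of the powers of \<open>N\<close>.\<close>

lemma partial_on_graph:
  fixes h :: "'n::{finite,linorder} rvec \<Rightarrow> real \<Rightarrow> 'b::euclidean_space"
  assumes E: "partials_well_defined E" and h: "smooth_family E h" and x: "x \<in> E"
  shows "partial_on E j (\<lambda>x. h x (c * x $ i)) x =
    pd E j h x (c * x $ i) + (if j = i then c *\<^sub>R td h x (c * x $ i) else 0)"
proof -
  obtain g where g: "family_extension E h g" using h smooth_on_def by blast
  define A where "A = (\<lambda>x :: 'n rvec. (x, c * x $ i))"
  have A: "bounded_linear A" unfolding A_def
    by (intro bounded_linear_Pair bounded_linear_ident bounded_linear_const_mult bounded_linear_vec_nth)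
  have ext: "smooth_extension E (\<lambda>x. h x (c * x $ i)) (\<lambda>x. g (A x))"
    using smooth_extension_compose_affine[OF g A, of E 0] by (simp add: A_def)
  define D where "D = frechet_derivative g (at (A x))"
  have D: "(g has_derivative D) (at (A x))"
    unfolding D_def using smooth_extension_has_derivative[OF g] x by (auto simp: A_def)
  interpret D: bounded_linear D using D has_derivative_bounded_linear by blast
  have "A (axis j 1) = (axis j 1, 0) + (if j = i then c else 0) *\<^sub>R (0, 1)"
    by (simp add: A_def axis_def)
  then have "D (A (axis j 1)) = D (axis j 1, 0) + (if j = i then c else 0) *\<^sub>R D (0, 1)"
    by (simp only: D.add D.scaleR)
  moreover have "partial_on E j (\<lambda>x. h x (c * x $ i)) x = D (A (axis j 1))"
    by (simp add: partial_on_eq[OF E ext x] frechet_derivative_eqI[OF has_derivative_compose[OF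
            bounded_linear_imp_has_derivative[OF A] D]])
  ultimately show ?thesis
    by (simp add: pd_eq[OF E g x] has_vector_derivative_td(2)[OF g x] D_def A_def)
qed

lemma loop_Int_eq_vint:
  fixes h :: "'n::{finite,linorder} rvec \<Rightarrow> real \<Rightarrow> 'm::finite rvec"
  assumes g: "family_extension E h g" and x: "x \<in> E"
  shows "loop_Int (h x) t = vint g (x, t) + (- t) *\<^sub>R vint g (x, 1)"
  using loop_Int_eq[OF smooth_family_continuous[OF smooth_extension_on[OF g] x], of t]
  by (simp add: interval_integral_eq_vint[OF g x] loop_mean_eq_vint[OF g x])

lemma smooth_family_loop_Int:
  fixes h :: "'n::{finite,linorder} rvec \<Rightarrow> real \<Rightarrow> 'm::finite rvec"
  assumes "smooth_family E h"
  shows "smooth_family E (\<lambda>x. loop_Int (h x))"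
proof -
  obtain g where g: "family_extension E h g" using assms smooth_on_def by blast
  have V: "smooth_on (E \<times> UNIV) (vint g)" by (rule smooth_extension_on[OF smooth_extension_vint(1)[OF g]])
  have "bounded_linear (\<lambda>p :: 'n rvec \<times> real. (fst p, 0 :: real))"
    by (intro bounded_linear_Pair bounded_linear_fst bounded_linear_zero)
  from smooth_on_compose_affine[OF V this, of "E \<times> UNIV" "(0, 1)"]
  have 1: "smooth_on (E \<times> UNIV) (\<lambda>p :: 'n rvec \<times> real. vint g (fst p, 1))" by auto
  have 2: "smooth_on (E \<times> UNIV) (\<lambda>p :: 'n rvec \<times> real. - snd p)"
    by (intro smooth_on_bounded_linear bounded_linear_minus bounded_linear_snd)
  have "smooth_on (E \<times> UNIV) (\<lambda>p. vint g p + (- snd p) *\<^sub>R vint g (fst p, 1))"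
    by (intro smooth_on_add V bounded_bilinear.smooth_on_bilinear[OF bounded_bilinear_scaleR] 1 2)
  then show ?thesis
    by (rule iffD1[OF smooth_on_cong, rotated]) (auto simp: loop_Int_eq_vint[OF g])
qed

lemma partial_on_vint:
  fixes h :: "'n::{finite,linorder} rvec \<Rightarrow> real \<Rightarrow> 'b::euclidean_space"
  assumes E: "partials_well_defined E" and g: "family_extension E h g" and x: "x \<in> E"
  shows "partial_on E j (\<lambda>y. vint g (y, t)) x =
    vint (\<lambda>q. frechet_derivative g (at q) (axis j 1, 0)) (x, t)"
proof -
  have "family_extension E (\<lambda>x t. vint g (x, t)) (vint g)"
    using smooth_extension_vint(1)[OF g] by simp
  from pd_eq[OF E this x, of j t]
    frechet_derivative_eqI[OF smooth_extension_vint(2)[OF g, of "(x, t)"]] x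
  show ?thesis by (simp add: pd_def)
qed

text \<open>Differentiation under the integral sign. The second claim serves to transfer vanishing
  means from a family to its space derivatives.\<close>

lemma pd_loop_Int:
  fixes h :: "'n::{finite,linorder} rvec \<Rightarrow> real \<Rightarrow> 'm::finite rvec"
  assumes E: "partials_well_defined E" and h: "smooth_family E h" and x: "x \<in> E"
  shows "pd E j (\<lambda>x. loop_Int (h x)) x t = loop_Int (pd E j h x) t"
    and "partial_on E j (\<lambda>x. loop_mean (h x)) x = loop_mean (pd E j h x)"
proof -
  obtain g where g: "family_extension E h g" using h smooth_on_def by blast
  have V: "smooth_on E (\<lambda>y. vint g (y, t))" for t
    using smooth_on_slice[of E "\<lambda>x t. vint g (x, t)"] smooth_extension_vint(1)[OF g]
    by (auto intro: smooth_extension_on)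
  have "pd E j (\<lambda>x. loop_Int (h x)) x t = partial_on E j (\<lambda>y. vint g (y, t) + (- t) *\<^sub>R vint g (y, 1)) x"
    unfolding pd_def by (rule partial_on_cong) (rule loop_Int_eq_vint[OF g])
  also have "\<dots> = partial_on E j (\<lambda>y. vint g (y, t)) x + (- t) *\<^sub>R partial_on E j (\<lambda>y. vint g (y, 1)) x"
    by (simp only: partial_on_add[OF E x V smooth_on_scaleR_const[OF V]] partial_on_scaleR[OF E x V])
  also have "\<dots> = loop_Int (pd E j h x) t"
    by (simp only: partial_on_vint[OF E g x] loop_Int_eq_vint[OF family_extension_pd[OF E g] x])
  finally show "pd E j (\<lambda>x. loop_Int (h x)) x t = loop_Int (pd E j h x) t" .
  have "partial_on E j (\<lambda>x. loop_mean (h x)) x = partial_on E j (\<lambda>y. vint g (y, 1)) x"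
    by (rule partial_on_cong) (rule loop_mean_eq_vint[OF g])
  then show "partial_on E j (\<lambda>x. loop_mean (h x)) x = loop_mean (pd E j h x)"
    by (simp add: partial_on_vint[OF E g x] loop_mean_eq_vint[OF family_extension_pd[OF E g] x])
qed

section \<open>Time derivative and periodicity of \<open>loop_Int\<close>\<close>

lemma has_vector_derivative_loop_Int:
  fixes h :: "real \<Rightarrow> 'm::finite rvec"
  assumes "continuous_on UNIV h"
  shows "(loop_Int h has_vector_derivative h t - loop_mean h) (at t)"
proof -
  \<comment> \<open>The margin \<open>1\<close> puts \<open>t\<close> in the interior of an interval
    containing \<open>0\<close>, so the derivative within it is two-sided.\<close>
  define a b where "a = min t 0 - 1" and "b = max t 0 + 1"
  have "((\<lambda>u. LBINT y=ereal 0..ereal u. h y - loop_mean h) has_vector_derivative h t - loop_mean h)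
      (at t within {a..b})"
    by (rule interval_integral_FTC2)
      (use assms in \<open>auto simp: a_def b_def intro!: continuous_intros intro: continuous_on_subset\<close>)
  moreover have "at t within {a..b} = at t"
    by (rule at_within_Icc_at) (auto simp: a_def b_def)
  ultimately show ?thesis by (simp add: loop_Int_def[abs_def] zero_ereal_def)
qed

text \<open>The increment over one period has derivative zero, hence equals its value at
  \<open>0\<close>. That value is the integral over one period minus the mean, which is
  zero.\<close>

lemma loop_Int_plus_1:
  fixes h :: "real \<Rightarrow> 'm::finite rvec"
  assumes h: "continuous_on UNIV h" and per: "\<And>t. h (t + 1) = h t"
  shows "loop_Int h (t + 1) = loop_Int h t"
proof -
  have 1: "(loop_Int h has_vector_derivative h t - loop_mean h) (at t)" for t
    by (rule has_vector_derivative_loop_Int[OF h])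
  have "((\<lambda>t. loop_Int h (t + 1) - loop_Int h t) has_vector_derivative 0) (at t)" for t
  proof -
    have "((\<lambda>t. t + 1) has_vector_derivative 1) (at t)"
      by (auto intro!: derivative_eq_intros)
    from vector_diff_chain_at[OF this 1]
    have "((\<lambda>t. loop_Int h (t + 1)) has_vector_derivative h t - loop_mean h) (at t)"
      by (simp add: o_def per)
    from has_vector_derivative_diff[OF this 1[of t]] show ?thesis by simp
  qed
  then have "loop_Int h (t + 1) - loop_Int h t = loop_Int h (0 + 1) - loop_Int h 0"
    by (intro has_derivative_zero_unique[of UNIV "\<lambda>t. loop_Int h (t + 1) - loop_Int h t"])
      (simp_all add: has_vector_derivative_def)
  also have "\<dots> = 0"
    using loop_Int_eq[OF h, of 1] loop_Int_eq[OF h, of 0]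
    by (simp add: loop_mean_def one_ereal_def zero_ereal_def)
  finally show ?thesis by simp
qed

lemma periodic_of_int:
  fixes h :: "real \<Rightarrow> 'b"
  assumes "\<And>t. h (t + 1) = h t"
  shows "h (t + of_int m) = h t"
proof (induction m rule: int_induct[where k = 0])
  case (step1 i)
  then show ?case using assms[of "t + of_int i"] by (simp add: algebra_simps)
next
  case (step2 i)
  then show ?case using assms[of "t + of_int (i - 1)"] by (simp add: algebra_simps)
qed simp

section \<open>Periodicity and compactness\<close>

lemma cyl_translate:
  assumes "x \<in> cyl d K" "k \<in> lattice_vecs d"
  shows "x + k \<in> cyl d K"
proof -
  have "(\<chi> i. if i \<in> last_ixs d then 0 else (x + k) $ i) = (\<chi> i. if i \<in> last_ixs d then 0 else x $ i)"
    using assms(2) by (auto simp: lattice_vecs_def vec_eq_iff split: if_splits)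
  then show ?thesis using assms(1) by (simp add: cyl_def)
qed

text \<open>The closed unit cube is used in the periodic directions to get a compact set; a lattice
  orbit may meet it more than once.\<close>

definition fund_dom :: "nat \<Rightarrow> 'n::{finite,linorder} rvec set \<Rightarrow> 'n rvec set" where
  "fund_dom d E = {x \<in> E. \<forall>i\<in>last_ixs d. x $ i \<in> {0..1}}"

lemma fund_dom_translate:
  fixes x :: "'n::{finite,linorder} rvec"
  assumes "x \<in> cyl d K"
  obtains k where "k \<in> lattice_vecs d" "x + k \<in> fund_dom d (cyl d K)"
proof
  define k :: "'n rvec" where "k = (\<chi> i. if i \<in> last_ixs d then - of_int \<lfloor>x $ i\<rfloor> else 0)"
  show k: "k \<in> lattice_vecs d" by (simp add: k_def lattice_vecs_def)
  have "(x + k) $ i \<in> {0..1}" if "i \<in> last_ixs d" for i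
    using that by (simp add: k_def) linarith
  then show "x + k \<in> fund_dom d (cyl d K)"
    using cyl_translate[OF assms k] by (simp add: fund_dom_def)
qed

lemma compact_fund_dom:
  fixes K :: "'n::{finite,linorder} rvec set"
  assumes "compact K"
  shows "compact (fund_dom d (cyl d K))"
proof -
  define p :: "'n rvec \<Rightarrow> 'n rvec" where "p = (\<lambda>x. \<chi> i. if i \<in> last_ixs d then 0 else x $ i)"
  have p: "continuous_on UNIV p"
    unfolding p_def
  proof (rule continuous_on_vec_lambda)
    show "continuous_on UNIV (\<lambda>x :: 'n rvec. if i \<in> last_ixs d then 0 else x $ i)" for i
      by (cases "i \<in> last_ixs d") (auto intro: continuous_intros)
  qed
  have "fund_dom d (cyl d K) = p -` K \<inter> (\<Inter>i\<in>last_ixs d. (\<lambda>x. x $ i) -` {0..1})"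
    by (auto simp: fund_dom_def cyl_def p_def)
  moreover have "closed (p -` K)"
    using closed_vimage[OF compact_imp_closed[OF assms] p] .
  moreover have "closed ((\<lambda>x :: 'n rvec. x $ i) -` {0..1})" for i
    by (intro closed_vimage continuous_intros)
  ultimately have closed: "closed (fund_dom d (cyl d K))" by (simp add: closed_Int closed_INT)
  obtain B where B: "\<And>y. y \<in> K \<Longrightarrow> norm y \<le> B" using compact_imp_bounded[OF assms] bounded_iff by metis
  have "bounded (fund_dom d (cyl d K))"
    unfolding bounded_iff
  proof (intro exI ballI)
    fix x assume x: "x \<in> fund_dom d (cyl d K)"
    \<comment> \<open>One bound for both kinds of coordinates: \<open>1\<close> from the unit cube,
      \<open>B\<close> from \<open>K\<close>. The absolute value covers a negative \<open>B\<close>,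
      possible when \<open>K\<close> is empty.\<close>
    have "\<bar>x $ i\<bar> \<le> \<bar>B\<bar> + 1" for i
    proof (cases "i \<in> last_ixs d")
      case True
      then show ?thesis using x by (auto simp: fund_dom_def)
    next
      case False
      have "p x \<in> K" using x by (simp add: fund_dom_def cyl_def p_def)
      then have "\<bar>p x $ i\<bar> \<le> B" using B component_le_norm_cart order_trans by blast
      then show ?thesis using False by (simp add: p_def)
    qed
    then have "(\<Sum>i\<in>UNIV. \<bar>x $ i\<bar>) \<le> (\<Sum>i\<in>(UNIV :: 'n set). \<bar>B\<bar> + 1)" by (intro sum_mono)
    then show "norm x \<le> (\<Sum>i\<in>(UNIV :: 'n set). \<bar>B\<bar> + 1)" using norm_le_l1_cart[of x] by linarith
  qed
  then show ?thesis using closed compact_eq_bounded_closed by blast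
qed

section \<open>Periodic functions and families of loops on \<open>E\<close>\<close>

locale cylinder =
  fixes d :: nat and K E :: "'n::{finite,linorder} rvec set"
  assumes compact_K: "compact K" and E_def: "E = cyl d K" and pwd: "partials_well_defined E"
begin

lemma translate: "x \<in> E \<Longrightarrow> k \<in> lattice_vecs d \<Longrightarrow> x + k \<in> E"
  using cyl_translate E_def by blast

lemma Cinf_per_smooth: "f \<in> Cinf_per d E \<Longrightarrow> smooth_on E f"
  by (simp add: Cinf_per_def)

lemma well_adapted_smooth: "well_adapted d E h \<Longrightarrow> smooth_family E h"
  by (simp add: well_adapted_def)

lemma well_adapted_periodic:
  "well_adapted d E h \<Longrightarrow> x \<in> E \<Longrightarrow> h x (t + of_int m) = h x t"
  by (rule periodic_of_int) (simp add: well_adapted_def)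

text \<open>By periodicity a translated extension of \<open>f\<close> again extends
  \<open>f\<close>, and the partial derivative does not depend on the extension chosen.\<close>

lemma partial_on_translate:
  fixes f :: "'n rvec \<Rightarrow> 'b::euclidean_space"
  assumes f: "f \<in> Cinf_per d E" and x: "x \<in> E" and k: "k \<in> lattice_vecs d"
  shows "partial_on E i f (x + k) = partial_on E i f x"
proof -
  obtain g where g: "smooth_extension E f g" using f by (auto simp: Cinf_per_def smooth_on_def)
  have "smooth_extension E (\<lambda>x. f (x + k)) (\<lambda>x. g (x + k))"
    by (rule smooth_extension_compose_affine[OF g bounded_linear_ident]) (rule translate[OF _ k])
  then have g': "smooth_extension E f (\<lambda>x. g (x + k))"
    by (rule iffD1[OF smooth_extension_cong, rotated]) (use f k in \<open>simp add: Cinf_per_def\<close>)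
  have 1: "((\<lambda>x. x + k) has_derivative (\<lambda>v. v)) (at x)"
    by (auto intro!: derivative_eq_intros)
  from frechet_derivative_eqI[OF has_derivative_compose[OF 1
        smooth_extension_has_derivative[OF g translate[OF x k]]]]
  show ?thesis
    by (simp add: partial_on_eq[OF pwd g' x] partial_on_eq[OF pwd g translate[OF x k]])
qed

lemma Cinf_per_partial_on:
  fixes f :: "'n rvec \<Rightarrow> 'b::euclidean_space"
  assumes "f \<in> Cinf_per d E"
  shows "partial_on E i f \<in> Cinf_per d E"
  using smooth_on_partial_on[OF pwd Cinf_per_smooth[OF assms]] partial_on_translate[OF assms]
  by (simp add: Cinf_per_def)

lemma Cinf_per_cong:
  assumes "\<And>x. x \<in> E \<Longrightarrow> f x = g x"
  shows "f \<in> Cinf_per d E \<longleftrightarrow> g \<in> Cinf_per d E"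
  using assms smooth_on_cong[of E f g] translate by (auto simp: Cinf_per_def)

lemma Cinf_per_add:
  "f \<in> Cinf_per d E \<Longrightarrow> g \<in> Cinf_per d E \<Longrightarrow> (\<lambda>x. f x + g x) \<in> Cinf_per d E"
  by (auto simp: Cinf_per_def smooth_on_add)

lemma Cinf_per_scaleR: "f \<in> Cinf_per d E \<Longrightarrow> (\<lambda>x. c *\<^sub>R f x) \<in> Cinf_per d E"
  by (auto simp: Cinf_per_def smooth_on_scaleR_const)

lemma well_adapted_slice: "well_adapted d E h \<Longrightarrow> (\<lambda>y. h y t) \<in> Cinf_per d E"
  using smooth_on_slice[of E h t] by (auto simp: Cinf_per_def well_adapted_def)

text \<open>As \<open>N\<close> is an integer, a lattice shift of \<open>x\<close> changes the time
  \<open>N * x $ i\<close> by an integer, which the loop does not see. This also covers the case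
  where \<open>i\<close> is a periodic direction.\<close>

lemma well_adapted_graph:
  assumes h: "well_adapted d E h"
  shows "(\<lambda>x. h x (real N * x $ i)) \<in> Cinf_per d E"
proof -
  have "h (x + k) (real N * (x + k) $ i) = h x (real N * x $ i)"
    if x: "x \<in> E" and k: "k \<in> lattice_vecs d" for x k
  proof -
    have "k $ i \<in> \<int>" using k by (auto simp: lattice_vecs_def dest: spec[of _ i] split: if_splits)
    then obtain m where "k $ i = of_int m" by (auto elim: Ints_cases)
    then have "real N * (x + k) $ i = real N * x $ i + of_int (int N * m)"
      by (simp add: algebra_simps)
    then have "h (x + k) (real N * (x + k) $ i) = h (x + k) (real N * x $ i)"
      using well_adapted_periodic[OF h translate[OF x k]] by metis
    also have "\<dots> = h x (real N * x $ i)" using h x k by (simp add: well_adapted_def)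
    finally show ?thesis .
  qed
  then show ?thesis using smooth_on_graph[OF well_adapted_smooth[OF h]] by (simp add: Cinf_per_def)
qed

lemma well_adapted_pd:
  fixes h :: "'n rvec \<Rightarrow> real \<Rightarrow> 'b::euclidean_space"
  assumes h: "well_adapted d E h"
  shows "well_adapted d E (pd E j h)"
proof -
  have "pd E j h x (t + 1) = pd E j h x t" for x t
    unfolding pd_def by (rule partial_on_cong) (use h in \<open>simp add: well_adapted_def\<close>)
  moreover have "pd E j h (x + k) t = pd E j h x t" if "x \<in> E" "k \<in> lattice_vecs d" for x k t
    unfolding pd_def by (rule partial_on_translate[OF well_adapted_slice[OF h] that])
  ultimately show ?thesis
    using smooth_family_pd[OF pwd well_adapted_smooth[OF h]] by (simp add: well_adapted_def)
qed

lemma well_adapted_td: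
  assumes h: "well_adapted d E h"
  shows "well_adapted d E (td h)"
proof -
  have "td h x (t + 1) = td h x t" if x: "x \<in> E" for x t
  proof -
    obtain g where g: "family_extension E h g"
      using well_adapted_smooth[OF h] smooth_on_def by blast
    have "((\<lambda>t. t + 1) has_vector_derivative 1) (at t)"
      by (auto intro!: derivative_eq_intros)
    from vector_diff_chain_at[OF this has_vector_derivative_td(1)[OF g x, of "t + 1"]]
    have "(h x has_vector_derivative td h x (t + 1)) (at t)"
      using h x by (simp add: o_def well_adapted_def)
    then show ?thesis unfolding td_def[of h x t] by (simp add: vector_derivative_at)
  qed
  moreover have "td h (x + k) t = td h x t" if "x \<in> E" "k \<in> lattice_vecs d" for x k t
  proof -
    have "h (x + k) = h x" using h that by (auto simp: well_adapted_def)
    then show ?thesis by (simp add: td_def)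
  qed
  ultimately show ?thesis
    using smooth_family_td[OF well_adapted_smooth[OF h]] by (simp add: well_adapted_def)
qed

lemma well_adapted_loop_Int:
  fixes h :: "'n rvec \<Rightarrow> real \<Rightarrow> 'm::finite rvec"
  assumes h: "well_adapted d E h"
  shows "well_adapted d E (\<lambda>x. loop_Int (h x))"
proof -
  have "loop_Int (h x) (t + 1) = loop_Int (h x) t" if "x \<in> E" for x t
    by (rule loop_Int_plus_1[OF smooth_family_continuous[OF well_adapted_smooth[OF h] that]])
      (use h that in \<open>simp add: well_adapted_def\<close>)
  moreover have "loop_Int (h (x + k)) t = loop_Int (h x) t"
    if "x \<in> E" "k \<in> lattice_vecs d" for x k t
  proof -
    have "h (x + k) = h x" using h that by (auto simp: well_adapted_def)
    then show ?thesis by simp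
  qed
  ultimately show ?thesis
    using smooth_family_loop_Int[OF well_adapted_smooth[OF h]] by (simp add: well_adapted_def)
qed

section \<open>Uniform bounds from compactness modulo the lattice\<close>

lemma Cinf_per_bounded:
  assumes "f \<in> Cinf_per d E"
  obtains B where "B > 0" "\<And>x. x \<in> E \<Longrightarrow> norm (f x) \<le> B"
proof -
  have "continuous_on (fund_dom d E) f"
    by (rule continuous_on_subset[OF smooth_on_imp_continuous_on[OF Cinf_per_smooth[OF assms]]])
      (auto simp: fund_dom_def)
  then have "bounded (f ` fund_dom d E)"
    using compact_fund_dom[OF compact_K] compact_continuous_image compact_imp_bounded E_def by metis
  then obtain B where B: "B > 0" "\<And>x. x \<in> fund_dom d E \<Longrightarrow> norm (f x) \<le> B"
    unfolding bounded_pos by blast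
  have "norm (f x) \<le> B" if x: "x \<in> E" for x
  proof -
    obtain k where "k \<in> lattice_vecs d" "x + k \<in> fund_dom d E"
      using fund_dom_translate x E_def by blast
    then show ?thesis using B(2)[of "x + k"] assms x by (simp add: Cinf_per_def)
  qed
  with B(1) show thesis using that by blast
qed

lemma well_adapted_bounded:
  assumes "well_adapted d E h"
  obtains B where "B > 0" "\<And>x t. x \<in> E \<Longrightarrow> norm (h x t) \<le> B"
proof -
  have "continuous_on (fund_dom d E \<times> {0..1}) (\<lambda>(x, t). h x t)"
    by (rule continuous_on_subset[OF smooth_on_imp_continuous_on[OF well_adapted_smooth[OF assms]]])
      (auto simp: fund_dom_def)
  moreover have "compact (fund_dom d E \<times> {0..1::real})"
    using compact_fund_dom[OF compact_K] E_def by (intro compact_Times) auto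
  ultimately have "bounded ((\<lambda>(x, t). h x t) ` (fund_dom d E \<times> {0..1}))"
    using compact_continuous_image compact_imp_bounded by blast
  then obtain B where B: "B > 0" "\<And>x t. x \<in> fund_dom d E \<Longrightarrow> t \<in> {0..1} \<Longrightarrow> norm (h x t) \<le> B"
    unfolding bounded_pos by fastforce
  have "norm (h x t) \<le> B" if x: "x \<in> E" for x t
  proof -
    obtain k where k: "k \<in> lattice_vecs d" "x + k \<in> fund_dom d E"
      using fund_dom_translate x E_def by blast
    \<comment> \<open>Both variables are moved into the compact set: space by \<open>k\<close>, time
      by its integer part.\<close>
    have "h x t = h (x + k) (frac t)"
      using assms x k well_adapted_periodic[OF assms x, of "frac t" "\<lfloor>t\<rfloor>"]
      by (simp add: well_adapted_def frac_def)
    then show ?thesis using B(2)[OF k(2), of "frac t"] frac_lt_1[of t] by (simp add: less_imp_le)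
  qed
  with B(1) show thesis using that by blast
qed

end

section \<open>Uniform estimates\<close>

text \<open>This is \<open>O(1/N)\<close> uniformly on \<open>E\<close>. The index \<open>0\<close>
  is excluded because \<open>F\<close> is only prescribed for positive \<open>N\<close>.\<close>

definition vanishing :: "'a set \<Rightarrow> (nat \<Rightarrow> 'a \<Rightarrow> 'b::real_normed_vector) \<Rightarrow> bool" where
  "vanishing E e \<longleftrightarrow> (\<exists>B. \<forall>N>0. \<forall>x\<in>E. norm (e N x) \<le> B / real N)"

lemma vanishingI: "(\<And>N x. N > 0 \<Longrightarrow> x \<in> E \<Longrightarrow> norm (e N x) \<le> B / real N) \<Longrightarrow> vanishing E e"
  unfolding vanishing_def by blast

lemma vanishingE:
  assumes "vanishing E e"
  obtains B where "\<And>N x. N > 0 \<Longrightarrow> x \<in> E \<Longrightarrow> norm (e N x) \<le> B / real N"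
  using assms unfolding vanishing_def by blast

lemma vanishing_cong:
  "vanishing E e \<Longrightarrow> (\<And>N x. N > 0 \<Longrightarrow> x \<in> E \<Longrightarrow> e' N x = e N x) \<Longrightarrow> vanishing E e'"
  unfolding vanishing_def by simp

lemma vanishing_zero: "vanishing E (\<lambda>N x. 0)"
  by (rule vanishingI[of _ _ 0]) simp

lemma vanishing_add:
  assumes "vanishing E e" "vanishing E e'"
  shows "vanishing E (\<lambda>N x. e N x + e' N x)"
proof -
  obtain B where B: "\<And>N x. N > 0 \<Longrightarrow> x \<in> E \<Longrightarrow> norm (e N x) \<le> B / real N"
    using vanishingE[OF assms(1)] by blast
  obtain B' where B': "\<And>N x. N > 0 \<Longrightarrow> x \<in> E \<Longrightarrow> norm (e' N x) \<le> B' / real N"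
    using vanishingE[OF assms(2)] by blast
  show ?thesis
  proof (rule vanishingI[of _ _ "B + B'"])
    fix N :: nat and x assume "N > 0" "x \<in> E"
    then show "norm (e N x + e' N x) \<le> (B + B') / real N"
      using norm_triangle_mono[OF B[of N x] B'[of N x]] by (simp add: add_divide_distrib)
  qed
qed

lemma vanishing_Pair:
  assumes "vanishing E e" "vanishing E e'"
  shows "vanishing E (\<lambda>N x. (e N x, e' N x))"
proof -
  obtain B where B: "\<And>N x. N > 0 \<Longrightarrow> x \<in> E \<Longrightarrow> norm (e N x) \<le> B / real N"
    using vanishingE[OF assms(1)] by blast
  obtain B' where B': "\<And>N x. N > 0 \<Longrightarrow> x \<in> E \<Longrightarrow> norm (e' N x) \<le> B' / real N"
    using vanishingE[OF assms(2)] by blast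
  show ?thesis
  proof (rule vanishingI[of _ _ "B + B'"])
    fix N :: nat and x assume "N > 0" "x \<in> E"
    then show "norm (e N x, e' N x) \<le> (B + B') / real N"
      using B[of N x] B'[of N x] norm_Pair_le[of "e N x" "e' N x"] by (simp add: add_divide_distrib)
  qed
qed

lemma vanishing_vec:
  fixes e :: "'n::finite \<Rightarrow> nat \<Rightarrow> 'a \<Rightarrow> 'b::real_normed_vector"
  assumes "\<And>i. vanishing E (e i)"
  shows "vanishing E (\<lambda>N x. \<chi> i. e i N x)"
proof -
  have "\<exists>B. \<forall>N>0. \<forall>x\<in>E. norm (e i N x) \<le> B / real N" for i
    using assms unfolding vanishing_def by blast
  then obtain B where B: "\<And>i N x. N > 0 \<Longrightarrow> x \<in> E \<Longrightarrow> norm (e i N x) \<le> B i / real N"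
    by metis
  show ?thesis
  proof (rule vanishingI[of _ _ "sum B UNIV"])
    fix N :: nat and x assume *: "N > 0" "x \<in> E"
    have "norm (\<chi> i. e i N x) \<le> (\<Sum>i\<in>UNIV. norm (e i N x))"
      using L2_set_le_sum[of UNIV "\<lambda>i. norm (e i N x)"] by (simp add: norm_vec_def)
    also have "\<dots> \<le> sum B UNIV / real N"
      unfolding sum_divide_distrib by (rule sum_mono) (rule B[OF *])
    finally show "norm (\<chi> i. e i N x) \<le> sum B UNIV / real N" .
  qed
qed

text \<open>The bound on \<open>h\<close> is uniform in time, so the sampling time
  \<open>t N x\<close> may depend on \<open>N\<close> and \<open>x\<close> in any way.\<close>

lemma vanishing_bound:
  assumes "\<And>x t. x \<in> E \<Longrightarrow> norm (h x t) \<le> B" "B \<ge> 0" "\<And>N. N > 0 \<Longrightarrow> \<bar>c N\<bar> \<le> 1 / real N"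
  shows "vanishing E (\<lambda>N x. c N *\<^sub>R h x (t N x))"
proof (rule vanishingI[of _ _ B])
  fix N :: nat and x assume "N > 0" "x \<in> E"
  then have "\<bar>c N\<bar> * norm (h x (t N x)) \<le> 1 / real N * B"
    using assms by (intro mult_mono) auto
  then show "norm (c N *\<^sub>R h x (t N x)) \<le> B / real N" by simp
qed

lemma vanishing_blinfun:
  assumes "vanishing E e" "\<And>x. x \<in> E \<Longrightarrow> norm (L x) \<le> C"
  shows "vanishing E (\<lambda>N x. blinfun_apply (L x) (e N x))"
proof -
  obtain B where B: "\<And>N x. N > 0 \<Longrightarrow> x \<in> E \<Longrightarrow> norm (e N x) \<le> B / real N"
    using vanishingE[OF assms(1)] by blast
  show ?thesis
  proof (rule vanishingI)
    fix N :: nat and x assume *: "N > 0" "x \<in> E"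
    have "norm (blinfun_apply (L x) (e N x)) \<le> norm (L x) * norm (e N x)" by (rule norm_blinfun)
    also have "\<dots> \<le> C * (B / real N)"
      using assms(2)[OF *(2)] B[OF *] order_trans[OF norm_ge_zero assms(2)[OF *(2)]]
      by (intro mult_mono) auto
    finally show "norm (blinfun_apply (L x) (e N x)) \<le> (C * B) / real N" by simp
  qed
qed

lemma vanishing_eventually:
  assumes "vanishing E e" "\<epsilon> > 0"
  shows "\<forall>\<^sub>F N in sequentially. N > 0 \<and> (\<forall>x\<in>E. norm (e N x) < \<epsilon>)"
proof -
  obtain B where B: "\<And>N x. N > 0 \<Longrightarrow> x \<in> E \<Longrightarrow> norm (e N x) \<le> B / real N"
    using vanishingE[OF assms(1)] by blast
  have "(\<lambda>N. B / real N) \<longlonglongrightarrow> 0" by (rule lim_const_over_n)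
  then have "\<forall>\<^sub>F N in sequentially. B / real N < \<epsilon>" using order_tendstoD(2) assms(2) by blast
  with eventually_gt_at_top[of 0] show ?thesis
    by eventually_elim (use B le_less_trans in blast)
qed

text \<open>Stronger than uniform continuity on \<open>C\<close>, since \<open>y\<close> may leave
  \<open>C\<close>. A Lebesgue number of the cover of \<open>C\<close> by sets on which
  \<open>g\<close> varies little serves as \<eta>.\<close>

lemma continuous_uniform_near_compact:
  fixes g :: "'a::metric_space \<Rightarrow> 'b::metric_space"
  assumes C: "compact C" "C \<subseteq> U" and U: "open U" and g: "continuous_on U g" and \<epsilon>: "\<epsilon> > 0"
  obtains \<eta> where "\<eta> > 0" "\<And>c y. c \<in> C \<Longrightarrow> dist y c < \<eta> \<Longrightarrow> y \<in> U \<and> dist (g y) (g c) < \<epsilon>"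
proof -
  define V where "V = (\<lambda>c. U \<inter> g -` ball (g c) (\<epsilon> / 2))"
  have 1: "open G" if "G \<in> V ` C" for G
    using that continuous_open_preimage[OF g U open_ball] by (auto simp: V_def)
  have 2: "C \<subseteq> \<Union> (V ` C)" using C(2) \<epsilon> by (auto simp: V_def)
  obtain \<eta> where \<eta>: "\<eta> > 0" "\<And>x. x \<in> C \<Longrightarrow> \<exists>G\<in>V ` C. ball x \<eta> \<subseteq> G"
    using Heine_Borel_lemma[OF C(1) 2 1] by metis
  show thesis
  proof (rule that[OF \<eta>(1)])
    fix c y assume c: "c \<in> C" and y: "dist y c < \<eta>"
    obtain b where b: "ball c \<eta> \<subseteq> V b" using \<eta>(2)[OF c] by blast
    have "y \<in> V b" "c \<in> V b" using b y \<eta>(1) by (auto simp: dist_commute subset_iff)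
    then have "y \<in> U" "dist (g b) (g y) < \<epsilon> / 2" "dist (g b) (g c) < \<epsilon> / 2" by (auto simp: V_def)
    then show "y \<in> U \<and> dist (g y) (g c) < \<epsilon>"
      using dist_triangle_half_r[of "g b" "g y" \<epsilon> "g c"] by simp
  qed
qed

section \<open>The corrugated map\<close>

text \<open>The formula for \<open>F\<close> holds only on \<open>E\<close> and for
  \<open>N > 0\<close>; its partial derivatives are accessible because \<open>partial_on\<close>
  depends only on values on \<open>E\<close>.\<close>

locale corrugation = cylinder d K E for d :: nat and K E :: "'n::{finite,linorder} rvec set" +
  fixes f :: "'n rvec \<Rightarrow> 'm::finite rvec" and \<gamma> \<delta> :: "'n rvec \<Rightarrow> real \<Rightarrow> 'm rvec"
    and F :: "nat \<Rightarrow> 'n rvec \<Rightarrow> 'm rvec"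
  assumes f: "f \<in> Cinf_per d E"
    and \<gamma>: "well_adapted d E \<gamma>" and \<delta>: "well_adapted d E \<delta>"
    and mean: "\<And>x. x \<in> E \<Longrightarrow> loop_mean (\<gamma> x) = 0" "\<And>x. x \<in> E \<Longrightarrow> loop_mean (\<delta> x) = 0"
    and F: "\<And>N x. N > 0 \<Longrightarrow> x \<in> E \<Longrightarrow>
      F N x = f x + (1 / real N) *\<^sub>R loop_Int (\<gamma> x) (real N * x $ fst_ix)
      + (1 / (real N)\<^sup>2) *\<^sub>R loop_Int (loop_Int (\<delta> x)) (real N * x $ fst_ix)"
begin

definition "\<Gamma> = (\<lambda>x. loop_Int (\<gamma> x))"
definition "\<Delta> = (\<lambda>x. loop_Int (loop_Int (\<delta> x)))"

lemma \<Gamma>: "well_adapted d E \<Gamma>" and \<Delta>: "well_adapted d E \<Delta>"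
  unfolding \<Gamma>_def \<Delta>_def by (intro well_adapted_loop_Int \<gamma> \<delta>)+

lemma td_\<Gamma>: "x \<in> E \<Longrightarrow> td \<Gamma> x t = \<gamma> x t"
  using has_vector_derivative_loop_Int[OF smooth_family_continuous[OF well_adapted_smooth[OF \<gamma>]], of x t]
  by (simp add: td_def \<Gamma>_def mean vector_derivative_at)

text \<open>Space derivatives commute with \<open>loop_Int\<close>, and
  \<open>pd E j \<gamma>\<close> inherits mean zero from \<gamma>, so no mean is subtracted when the
  primitive is differentiated.\<close>

lemma td_pd_\<Gamma>:
  assumes x: "x \<in> E"
  shows "td (pd E j \<Gamma>) x t = pd E j \<gamma> x t"
proof -
  note s = well_adapted_smooth[OF \<gamma>]
  have "pd E j \<Gamma> x = loop_Int (pd E j \<gamma> x)"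
    unfolding \<Gamma>_def by (rule ext) (rule pd_loop_Int(1)[OF pwd s x])
  moreover have "loop_mean (pd E j \<gamma> x) = 0"
  proof -
    have "loop_mean (pd E j \<gamma> x) = partial_on E j (\<lambda>x. loop_mean (\<gamma> x)) x"
      by (rule pd_loop_Int(2)[OF pwd s x, symmetric])
    also have "\<dots> = partial_on E j (\<lambda>x. 0) x" by (rule partial_on_cong) (rule mean)
    also have "\<dots> = 0" by (rule partial_on_const[OF pwd x])
    finally show ?thesis .
  qed
  ultimately show ?thesis
    using has_vector_derivative_loop_Int[OF smooth_family_continuous[OF smooth_family_pd[OF pwd s] x], of j t]
    by (simp add: td_def vector_derivative_at)
qed

text \<open>\<open>loop_Int (\<delta> x)\<close> may have nonzero mean, but this is constant in time
  and disappears in the second derivative; the mean of \<delta> itself is zero.\<close>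

lemma td_td_\<Delta>:
  assumes x: "x \<in> E"
  shows "td (td \<Delta>) x t = \<delta> x t"
proof -
  note s = well_adapted_smooth[OF \<delta>]
  have "td \<Delta> x t = loop_Int (\<delta> x) t - loop_mean (loop_Int (\<delta> x))" for t
    using has_vector_derivative_loop_Int[OF smooth_family_continuous[OF smooth_family_loop_Int[OF s] x], of t]
    by (simp add: td_def \<Delta>_def vector_derivative_at)
  then have *: "td \<Delta> x = (\<lambda>t. loop_Int (\<delta> x) t - loop_mean (loop_Int (\<delta> x)))" by blast
  from has_vector_derivative_diff[OF has_vector_derivative_loop_Int[OF smooth_family_continuous[OF s x], of t]
      has_vector_derivative_const]
  show ?thesis unfolding td_def[of "td \<Delta>"] * by (simp add: mean x vector_derivative_at)
qed

section \<open>First and second derivatives of the corrugated map\<close>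

abbreviation gr :: "('n rvec \<Rightarrow> real \<Rightarrow> 'm rvec) \<Rightarrow> nat \<Rightarrow> 'n rvec \<Rightarrow> 'm rvec" where
  "gr h N x \<equiv> h x (real N * x $ fst_ix)"

lemma gr_scaled_Cinf:
  "well_adapted d E h \<Longrightarrow> (\<lambda>x. c *\<^sub>R gr h N x) \<in> Cinf_per d E"
  by (intro Cinf_per_scaleR well_adapted_graph)

lemma partial_gr_scaled:
  assumes "well_adapted d E h" "x \<in> E"
  shows "partial_on E j (\<lambda>x. c *\<^sub>R gr h N x) x
    = c *\<^sub>R gr (pd E j h) N x + (if j = fst_ix then (c * real N) *\<^sub>R gr (td h) N x else 0)"
  using partial_on_scaleR[OF pwd assms(2) Cinf_per_smooth[OF well_adapted_graph[OF assms(1)]], of j c N fst_ix]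
  by (simp add: partial_on_graph[OF pwd well_adapted_smooth[OF assms(1)] assms(2)] scaleR_add_right)

lemma partial_add:
  assumes "u \<in> Cinf_per d E" "v \<in> Cinf_per d E" "x \<in> E"
  shows "partial_on E j (\<lambda>x. u x + v x :: 'm rvec) x = partial_on E j u x + partial_on E j v x"
  using assms by (intro partial_on_add[OF pwd] Cinf_per_smooth)

lemma F_eq: "N > 0 \<Longrightarrow> x \<in> E \<Longrightarrow>
    F N x = f x + (1 / real N) *\<^sub>R gr \<Gamma> N x + (1 / (real N)\<^sup>2) *\<^sub>R gr \<Delta> N x"
  by (simp add: F \<Gamma>_def \<Delta>_def)

lemma F_Cinf:
  assumes "N > 0" shows "F N \<in> Cinf_per d E"
proof -
  have "(\<lambda>x. f x + (1 / real N) *\<^sub>R gr \<Gamma> N x + (1 / (real N)\<^sup>2) *\<^sub>R gr \<Delta> N x) \<in> Cinf_per d E"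
    by (intro Cinf_per_add f gr_scaled_Cinf \<Gamma> \<Delta>)
  then show ?thesis using Cinf_per_cong[of "F N"] F_eq[OF assms] by simp
qed

text \<open>Differentiating time costs a factor \<open>N\<close>: this raises the \<Gamma> term to
  order one, giving \<gamma>, while the \<Delta> term remains of order \<open>1/N\<close>.\<close>

lemma partial_F:
  assumes N: "N > 0" and x: "x \<in> E"
  shows "partial_on E j (F N) x = partial_on E j f x
    + (1 / real N) *\<^sub>R gr (pd E j \<Gamma>) N x + (1 / (real N)\<^sup>2) *\<^sub>R gr (pd E j \<Delta>) N x
    + (if j = fst_ix then gr \<gamma> N x + (1 / real N) *\<^sub>R gr (td \<Delta>) N x else 0)"
proof -
  have "partial_on E j (F N) x
    = partial_on E j (\<lambda>x. f x + (1 / real N) *\<^sub>R gr \<Gamma> N x + (1 / (real N)\<^sup>2) *\<^sub>R gr \<Delta> N x) x"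
    by (rule partial_on_cong) (rule F_eq[OF N])
  also have "\<dots> = partial_on E j f x + partial_on E j (\<lambda>x. (1 / real N) *\<^sub>R gr \<Gamma> N x) x
      + partial_on E j (\<lambda>x. (1 / (real N)\<^sup>2) *\<^sub>R gr \<Delta> N x) x"
    by (simp only: partial_add Cinf_per_add f gr_scaled_Cinf \<Gamma> \<Delta> x)
  finally show ?thesis
    using N by (simp add: partial_gr_scaled \<Gamma> \<Delta> x td_\<Gamma> power2_eq_square)
qed

text \<open>With \<open>j\<close> not the first index, at most the outer derivative produces a
  factor \<open>N\<close>. In the jet, where \<open>i \<le> j\<close>, this covers all entries but
  the pure second derivative in the first variable.\<close>

lemma partial2_F:
  assumes N: "N > 0" and x: "x \<in> E" and j: "j \<noteq> fst_ix"
  shows "partial_on E i (partial_on E j (F N)) x = partial_on E i (partial_on E j f) x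
    + (1 / real N) *\<^sub>R gr (pd E i (pd E j \<Gamma>)) N x + (1 / (real N)\<^sup>2) *\<^sub>R gr (pd E i (pd E j \<Delta>)) N x
    + (if i = fst_ix then gr (pd E j \<gamma>) N x + (1 / real N) *\<^sub>R gr (td (pd E j \<Delta>)) N x else 0)"
proof -
  have "partial_on E i (partial_on E j (F N)) x = partial_on E i (\<lambda>x. partial_on E j f x
    + (1 / real N) *\<^sub>R gr (pd E j \<Gamma>) N x + (1 / (real N)\<^sup>2) *\<^sub>R gr (pd E j \<Delta>) N x) x"
    by (rule partial_on_cong) (simp add: partial_F[OF N] j)
  also have "\<dots> = partial_on E i (partial_on E j f) x
    + partial_on E i (\<lambda>x. (1 / real N) *\<^sub>R gr (pd E j \<Gamma>) N x) x
    + partial_on E i (\<lambda>x. (1 / (real N)\<^sup>2) *\<^sub>R gr (pd E j \<Delta>) N x) x"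
    by (simp only: partial_add Cinf_per_add Cinf_per_partial_on f gr_scaled_Cinf well_adapted_pd \<Gamma> \<Delta> x)
  finally show ?thesis
    using N by (simp add: partial_gr_scaled well_adapted_pd \<Gamma> \<Delta> x td_pd_\<Gamma> power2_eq_square)
qed

text \<open>The coefficient \<open>2\<close> collects two contributions: the time derivative of
  \<open>pd E i \<Gamma>\<close> and the space derivative of \<gamma>. The term with \<delta> comes
  from differentiating \<open>td \<Delta>\<close> in time.\<close>

lemma partial2_F_first:
  assumes N: "N > 0" and x: "x \<in> E" and i: "i = fst_ix"
  shows "partial_on E i (partial_on E i (F N)) x = partial_on E i (partial_on E i f) x
    + real N *\<^sub>R gr (td \<gamma>) N x + 2 *\<^sub>R gr (pd E i \<gamma>) N x + gr \<delta> N x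
    + ((1 / real N) *\<^sub>R gr (pd E i (pd E i \<Gamma>)) N x + (1 / (real N)\<^sup>2) *\<^sub>R gr (pd E i (pd E i \<Delta>)) N x
      + (1 / real N) *\<^sub>R gr (td (pd E i \<Delta>)) N x + (1 / real N) *\<^sub>R gr (pd E i (td \<Delta>)) N x)"
proof -
  \<comment> \<open>The factor \<open>1\<close> before \<open>gr \<gamma> N x\<close> gives this
    term the form required by \<open>partial_gr_scaled\<close>.\<close>
  have "partial_on E i (partial_on E i (F N)) x = partial_on E i (\<lambda>x. partial_on E i f x
    + (1 / real N) *\<^sub>R gr (pd E i \<Gamma>) N x + (1 / (real N)\<^sup>2) *\<^sub>R gr (pd E i \<Delta>) N x
    + (1 *\<^sub>R gr \<gamma> N x + (1 / real N) *\<^sub>R gr (td \<Delta>) N x)) x"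
    by (rule partial_on_cong) (simp add: partial_F[OF N] i)
  also have "\<dots> = partial_on E i (partial_on E i f) x
    + partial_on E i (\<lambda>x. (1 / real N) *\<^sub>R gr (pd E i \<Gamma>) N x) x
    + partial_on E i (\<lambda>x. (1 / (real N)\<^sup>2) *\<^sub>R gr (pd E i \<Delta>) N x) x
    + (partial_on E i (\<lambda>x. 1 *\<^sub>R gr \<gamma> N x) x + partial_on E i (\<lambda>x. (1 / real N) *\<^sub>R gr (td \<Delta>) N x) x)"
    by (simp only: partial_add Cinf_per_add Cinf_per_partial_on f gr_scaled_Cinf well_adapted_pd
        well_adapted_td \<Gamma> \<Delta> \<gamma> x)
  finally show ?thesis
    using N by (simp only: partial_gr_scaled well_adapted_pd well_adapted_td \<gamma> \<Gamma> \<Delta> x td_pd_\<Gamma> td_td_\<Delta> i if_True)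
      (simp add: power2_eq_square scaleR_2)
qed

section \<open>Uniform error estimates for the jet of \<open>F\<close>\<close>

lemma vanishing_gr:
  assumes "well_adapted d E (h :: 'n rvec \<Rightarrow> real \<Rightarrow> 'm rvec)"
  shows "vanishing E (\<lambda>N x. (1 / real N) *\<^sub>R gr h N x)"
    and "vanishing E (\<lambda>N x. (1 / (real N)\<^sup>2) *\<^sub>R gr h N x)"
proof -
  obtain B where B: "B > 0" "\<And>x t. x \<in> E \<Longrightarrow> norm (h x t) \<le> B"
    using well_adapted_bounded[OF assms] by metis
  show "vanishing E (\<lambda>N x. (1 / real N) *\<^sub>R gr h N x)"
    by (rule vanishing_bound[OF B(2)]) (use B(1) in auto)
  show "vanishing E (\<lambda>N x. (1 / (real N)\<^sup>2) *\<^sub>R gr h N x)"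
    by (rule vanishing_bound[OF B(2)])
      (use B(1) in \<open>auto simp: power2_eq_square divide_simps\<close>)
qed

lemma vanishing_F: "vanishing E (\<lambda>N x. F N x - f x)"
  by (rule vanishing_cong[OF vanishing_add[OF vanishing_gr(1)[OF \<Gamma>] vanishing_gr(2)[OF \<Delta>]]])
    (simp add: F_eq)

lemma vanishing_if:
  "(P \<Longrightarrow> vanishing E e) \<Longrightarrow> vanishing E (\<lambda>N x. if P then e N x else 0)"
  by (cases P) (auto intro: vanishing_zero)

lemma vanishing_partial_F:
  "vanishing E (\<lambda>N x. partial_on E j (F N) x - partial_on E j f x - (if j = fst_ix then gr \<gamma> N x else 0))"
proof (rule vanishing_cong)
  show "vanishing E (\<lambda>N x. (1 / real N) *\<^sub>R gr (pd E j \<Gamma>) N x + (1 / (real N)\<^sup>2) *\<^sub>R gr (pd E j \<Delta>) N x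
      + (if j = fst_ix then (1 / real N) *\<^sub>R gr (td \<Delta>) N x else 0))"
    by (intro vanishing_add vanishing_if vanishing_gr well_adapted_pd well_adapted_td \<Gamma> \<Delta>)
qed (simp add: partial_F)

lemma vanishing_partial2_F:
  assumes j: "j \<noteq> fst_ix"
  shows "vanishing E (\<lambda>N x. partial_on E i (partial_on E j (F N)) x - partial_on E i (partial_on E j f) x
    - (if i = fst_ix then gr (pd E j \<gamma>) N x else 0))"
proof (rule vanishing_cong)
  show "vanishing E (\<lambda>N x. (1 / real N) *\<^sub>R gr (pd E i (pd E j \<Gamma>)) N x
      + (1 / (real N)\<^sup>2) *\<^sub>R gr (pd E i (pd E j \<Delta>)) N x
      + (if i = fst_ix then (1 / real N) *\<^sub>R gr (td (pd E j \<Delta>)) N x else 0))"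
    by (intro vanishing_add vanishing_if vanishing_gr well_adapted_pd well_adapted_td \<Gamma> \<Delta>)
qed (simp add: partial2_F j)

text \<open>The term with factor \<open>real N\<close> is in general unbounded, so it stays in the
  main part until \<open>L\<close> annihilates it.\<close>

lemma vanishing_partial2_F_first:
  assumes i: "i = fst_ix"
  shows "vanishing E (\<lambda>N x. partial_on E i (partial_on E i (F N)) x - (partial_on E i (partial_on E i f) x
    + real N *\<^sub>R gr (td \<gamma>) N x + 2 *\<^sub>R gr (pd E i \<gamma>) N x + gr \<delta> N x))"
proof (rule vanishing_cong)
  show "vanishing E (\<lambda>N x. (1 / real N) *\<^sub>R gr (pd E i (pd E i \<Gamma>)) N x
      + (1 / (real N)\<^sup>2) *\<^sub>R gr (pd E i (pd E i \<Delta>)) N x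
      + (1 / real N) *\<^sub>R gr (td (pd E i \<Delta>)) N x + (1 / real N) *\<^sub>R gr (pd E i (td \<Delta>)) N x)"
    by (intro vanishing_add vanishing_gr well_adapted_pd well_adapted_td \<Gamma> \<Delta>)
qed (simp add: partial2_F_first i)

end

section \<open>The semilinear expression\<close>

lemma fst_ix_le: "fst_ix \<le> (j :: 'n::{finite,linorder})"
  by (simp add: fst_ix_def)

text \<open>This is the argument of \<open>R\<close> on the 2-jet of \<open>u\<close>, written out
  in partial derivatives so that the error estimates apply entry by entry.\<close>

definition R_arg :: "'n::{finite,linorder} rvec set \<Rightarrow> ('n rvec \<Rightarrow> 'm::finite rvec) \<Rightarrow> 'n rvec \<Rightarrow>
    'n rvec \<times> ('n, 'm) cjet \<times> 'm rvec \<times> ('n, 'm) fam" where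
  "R_arg E u x = (x,
     (u x, (\<chi> i. if i = fst_ix then 0 else partial_on E i u x),
      (\<chi> i j. if i \<noteq> fst_ix \<and> i \<le> j then partial_on E i (partial_on E j u) x else 0)),
     partial_on E fst_ix u x,
     (\<chi> j. if j = fst_ix then 0 else partial_on E fst_ix (partial_on E j u) x))"

lemma R_arg_jet2:
  assumes "jet2 E u x = (x, s0, s1, s2)"
  shows "R_arg E u x = (x, check (x, s0, s1, s2), s1 $ fst_ix, tail (s2 $ fst_ix))"
proof -
  have "s0 = u x" "s1 = (\<chi> i. partial_on E i u x)"
    "s2 = (\<chi> i j. if i \<le> j then partial_on E i (partial_on E j u) x else 0)"
    using assms by (auto simp: jet2_def)
  then show ?thesis by (simp add: R_arg_def tail_def vec_eq_iff fst_ix_le)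
qed

lemma semilinear_expr_jet2:
  "semilinear_expr L R (jet2 E u x) =
    blinfun_apply (L x) (partial_on E fst_ix (partial_on E fst_ix u) x) + R (R_arg E u x)"
proof -
  obtain s0 s1 s2 where s: "jet2 E u x = (x, s0, s1, s2)" by (simp add: jet2_def)
  then have "s2 $ fst_ix $ fst_ix = partial_on E fst_ix (partial_on E fst_ix u) x"
    by (auto simp: jet2_def)
  then show ?thesis by (simp only: s R_arg_jet2[OF s] semilinear_expr.simps)
qed

lemma jet2_in_J2: "x \<in> E \<Longrightarrow> jet2 E u x \<in> J2 E"
  by (auto simp: jet2_def J2_def)

text \<open>Tails are closed under addition and the slot of \<open>p\<close> is unrestricted, so the
  shifted argument in (L3) stays where \<open>R\<close> agrees with its extensions.\<close>

lemma R_arg_plus_in_R_dom: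
  fixes u :: "'n::{finite,linorder} rvec \<Rightarrow> 'm::finite rvec"
  assumes "x \<in> E"
  shows "R_arg E u x + (0, 0, p, tail w) \<in> R_dom E"
proof -
  obtain s0 s1 s2 where s: "jet2 E u x = (x, s0, s1, s2)" by (simp add: jet2_def)
  have "tail (s2 $ fst_ix) + tail w = tail (s2 $ fst_ix + w)"
    by (simp add: tail_def vec_eq_iff)
  moreover have "check (x, s0, s1, s2) \<in> check ` J2 E"
    using jet2_in_J2[OF assms, of u] unfolding s by (rule imageI)
  ultimately show ?thesis
    using assms by (simp add: R_arg_jet2[OF s] R_dom_def cJ2_def del: check.simps)
qed

lemma R_arg_in_R_dom:
  fixes u :: "'n::{finite,linorder} rvec \<Rightarrow> 'm::finite rvec"
  assumes "x \<in> E"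
  shows "R_arg E u x \<in> R_dom E"
proof -
  have "tail 0 = (0 :: ('n, 'm) fam)" by (simp add: tail_def vec_eq_iff)
  then show ?thesis using R_arg_plus_in_R_dom[OF assms, of u 0 0] by (simp flip: zero_prod_def)
qed

section \<open>Lattice invariance of the expression and annihilation by \<open>L\<close>\<close>

context cylinder
begin

lemma R_arg_translate:
  assumes "u \<in> Cinf_per d E" "x \<in> E" "k \<in> lattice_vecs d"
  shows "R_arg E u (x + k) = R_arg E u x + (k, 0, 0, 0)"
proof -
  have "u (x + k) = u x" using assms by (simp add: Cinf_per_def)
  then show ?thesis
    by (simp add: R_arg_def partial_on_translate[OF assms]
        partial_on_translate[OF Cinf_per_partial_on[OF assms(1)] assms(2,3)] cong: if_cong)
qed

text \<open>Reduces the estimate on \<open>E\<close> to the compact fundamental domain.\<close>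

lemma semilinear_expr_translate:
  assumes R: "semilinear_in_x1 d E Rel L R" and u: "u \<in> Cinf_per d E"
    and x: "x \<in> E" and k: "k \<in> lattice_vecs d"
  shows "semilinear_expr L R (jet2 E u (x + k)) = semilinear_expr L R (jet2 E u x)"
proof -
  have "L (x + k) = L x" using R x k by (simp add: semilinear_in_x1_def Cinf_per_def)
  moreover have "R (R_arg E u (x + k)) = R (R_arg E u x)"
  proof -
    obtain c p w where s: "R_arg E u x = (x, c, p, w)" by (simp add: R_arg_def)
    have "\<forall>(x, c, p, w)\<in>R_dom E. \<forall>k\<in>lattice_vecs d. R (x + k, c, p, w) = R (x, c, p, w)"
      using R by (simp add: semilinear_in_x1_def)
    with R_arg_in_R_dom[OF x, of u] k have "R (x + k, c, p, w) = R (x, c, p, w)"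
      unfolding s by blast
    then show ?thesis by (simp add: R_arg_translate[OF u x k] s)
  qed
  ultimately show ?thesis
    by (simp add: semilinear_expr_jet2 partial_on_translate[OF Cinf_per_partial_on[OF u] x k])
qed

lemma blinfun_annihilates_td:
  fixes L :: "'n rvec \<Rightarrow> 'm::finite rvec \<Rightarrow>\<^sub>L real"
  assumes h: "smooth_family E h" and x: "x \<in> E" and Lh: "\<And>t. blinfun_apply (L x) (h x t) = 0"
  shows "blinfun_apply (L x) (td h x t) = 0"
proof -
  obtain g where g: "family_extension E h g" using h smooth_on_def by blast
  from bounded_linear.has_vector_derivative[OF blinfun.bounded_linear_right[of "L x"] has_vector_derivative_td(1)[OF g x]]
  have "((\<lambda>t. 0 :: real) has_vector_derivative blinfun_apply (L x) (td h x t)) (at t)"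
    using Lh by simp
  from vector_derivative_unique_at[OF this has_vector_derivative_const] show ?thesis .
qed

text \<open>The product rule for the vanishing function \<open>L \<cdot> h\<close> leaves \<open>L
  \<cdot> \<partial>\<^sub>jh = - \<partial>\<^sub>jL \<cdot> h\<close>, which is zero by the last
  hypothesis; this is the use of the second half of (L2).\<close>

lemma blinfun_annihilates_pd:
  fixes L :: "'n rvec \<Rightarrow> 'm::finite rvec \<Rightarrow>\<^sub>L real"
  assumes L: "smooth_on E L" and h: "smooth_family E h" and x: "x \<in> E"
    and Lh: "\<And>x. x \<in> E \<Longrightarrow> blinfun_apply (L x) (h x t) = 0"
    and DLh: "blinfun_apply (partial_on E j L x) (h x t) = 0"
  shows "blinfun_apply (L x) (pd E j h x t) = 0"
proof -
  obtain L' where L': "smooth_extension E L L'" using L smooth_on_def by blast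
  obtain h' where h': "smooth_extension E (\<lambda>y. h y t) h'"
    using smooth_on_slice[OF h] smooth_on_def by blast
  have "0 = partial_on E j (\<lambda>y. 0 :: real) x" using partial_on_const[OF pwd x] by simp
  also have "\<dots> = partial_on E j (\<lambda>y. blinfun_apply (L y) (h y t)) x"
    by (rule partial_on_cong) (simp add: Lh)
  also have "\<dots> = blinfun_apply (L' x) (frechet_derivative h' (at x) (axis j 1))
      + blinfun_apply (frechet_derivative L' (at x) (axis j 1)) (h' x)"
    by (simp add: partial_on_eq[OF pwd blinfun.smooth_extension_bilinear[OF L' h'] x]
        frechet_derivative_eqI[OF blinfun.FDERIV[OF smooth_extension_has_derivative[OF L' x]
            smooth_extension_has_derivative[OF h' x]]])
  also have "\<dots> = blinfun_apply (L x) (pd E j h x t) + blinfun_apply (partial_on E j L x) (h x t)"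
    using L' h' x by (simp add: pd_def partial_on_eq[OF pwd h' x] partial_on_eq_blinfun[OF pwd L' x]
        smooth_extension_def)
  finally show ?thesis using DLh by simp
qed

end

context corrugation
begin

text \<open>This is the argument of \<open>R\<close> in (L3). Keeping the time \<open>t\<close>
  separate from \<open>N * x $ fst_ix\<close> makes it independent of \<open>N\<close>, so one
  compact set of arguments serves all \<open>N\<close>.\<close>

definition R_limit :: "'n rvec \<Rightarrow> real \<Rightarrow> 'n rvec \<times> ('n, 'm) cjet \<times> 'm rvec \<times> ('n, 'm) fam" where
  "R_limit x t = R_arg E f x + (0, 0, \<gamma> x t, tail (\<chi> j. pd E j \<gamma> x t))"

lemma vanishing_R_arg: "vanishing E (\<lambda>N x. R_arg E (F N) x - R_limit x (real N * x $ fst_ix))"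
proof (rule vanishing_cong)
  \<comment> \<open>The inner conditionals are vacuous and only match the shape of the earlier
    estimates. For the matrix, \<open>i \<noteq> fst_ix\<close> and \<open>i \<le> j\<close> force
    \<open>j \<noteq> fst_ix\<close>, as \<open>vanishing_partial2_F\<close> requires.\<close>
  show "vanishing E (\<lambda>N x. (0 :: 'n rvec,
    (F N x - f x,
     (\<chi> i. if i \<noteq> fst_ix then partial_on E i (F N) x - partial_on E i f x
        - (if i = fst_ix then gr \<gamma> N x else 0) else 0),
     (\<chi> i j. if i \<noteq> fst_ix \<and> i \<le> j then
        partial_on E i (partial_on E j (F N)) x - partial_on E i (partial_on E j f) x
        - (if i = fst_ix then gr (pd E j \<gamma>) N x else 0) else 0)),
    partial_on E fst_ix (F N) x - partial_on E fst_ix f x - gr \<gamma> N x,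
    (\<chi> j. if j \<noteq> fst_ix then
        partial_on E fst_ix (partial_on E j (F N)) x - partial_on E fst_ix (partial_on E j f) x
        - gr (pd E j \<gamma>) N x else 0)))"
    by (intro vanishing_Pair vanishing_vec vanishing_zero vanishing_F vanishing_if
        vanishing_partial_F vanishing_partial2_F vanishing_partial_F[of fst_ix, simplified]
        vanishing_partial2_F[of _ fst_ix, simplified])
      (auto dest: antisym[OF _ fst_ix_le])
qed (auto simp: R_arg_def R_limit_def tail_def vec_eq_iff)

lemma continuous_R_limit: "continuous_on (E \<times> UNIV) (\<lambda>(x, t). R_limit x t)"
proof -
  have 1: "continuous_on (E \<times> UNIV) (\<lambda>p. u (fst p))" if "u \<in> Cinf_per d E" for u :: "'n rvec \<Rightarrow> 'm rvec"
    by (rule continuous_on_compose2[OF smooth_on_imp_continuous_on[OF Cinf_per_smooth[OF that]]])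
      (auto intro: continuous_intros)
  have 2: "continuous_on (E \<times> UNIV) (\<lambda>p. h (fst p) (snd p))" if "well_adapted d E h" for h :: "'n rvec \<Rightarrow> real \<Rightarrow> 'm rvec"
    using smooth_on_imp_continuous_on[OF well_adapted_smooth[OF that]] by (simp add: split_beta)
  have 3: "continuous_on S (\<lambda>p. if P then v p else 0)" if "P \<Longrightarrow> continuous_on S v"
    for P S and v :: "'n rvec \<times> real \<Rightarrow> 'm rvec"
    using that by (cases P) auto
  have eq: "(\<lambda>(x, t). R_limit x t) = (\<lambda>p. (fst p,
     (f (fst p), (\<chi> i. if i \<noteq> fst_ix then partial_on E i f (fst p) else 0),
      (\<chi> i j. if i \<noteq> fst_ix \<and> i \<le> j then partial_on E i (partial_on E j f) (fst p) else 0)),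
     partial_on E fst_ix f (fst p) + \<gamma> (fst p) (snd p),
     (\<chi> j. if j \<noteq> fst_ix then
        partial_on E fst_ix (partial_on E j f) (fst p) + pd E j \<gamma> (fst p) (snd p) else 0)))"
    by (auto simp: fun_eq_iff R_limit_def R_arg_def tail_def vec_eq_iff)
  show ?thesis
    unfolding eq
    by (intro continuous_on_Pair continuous_on_vec_lambda continuous_on_add continuous_on_fst
        continuous_on_id 3 1 2 f \<gamma> Cinf_per_partial_on well_adapted_pd)
qed

lemma R_limit_in_R_dom: "x \<in> E \<Longrightarrow> R_limit x t \<in> R_dom E"
  unfolding R_limit_def by (rule R_arg_plus_in_R_dom)

lemma R_limit_frac:
  assumes "x \<in> E"
  shows "R_limit x (frac t) = R_limit x t"
proof -
  have "h x t = h x (frac t)" if "well_adapted d E h" for h :: "'n rvec \<Rightarrow> real \<Rightarrow> 'm rvec"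
    using well_adapted_periodic[OF that assms, of "frac t" "\<lfloor>t\<rfloor>"] by (simp add: frac_def)
  from this[OF \<gamma>] this[OF well_adapted_pd[OF \<gamma>]] show ?thesis by (simp add: R_limit_def)
qed

text \<open>\<open>R_dom E\<close> need not be open, so the comparison is made for an extension
  \<open>R'\<close> on an open set. Both arguments lie in \<open>R_dom E\<close>, where
  \<open>R'\<close> equals \<open>R\<close>.\<close>

lemma R_uniformly_close:
  fixes R :: "'n rvec \<times> ('n, 'm) cjet \<times> 'm rvec \<times> ('n, 'm) fam \<Rightarrow> real"
  assumes R: "smooth_on (R_dom E) R" and \<epsilon>: "\<epsilon> > 0"
  shows "\<forall>\<^sub>F N in sequentially. \<forall>x\<in>fund_dom d E.
    \<bar>R (R_arg E (F N) x) - R (R_limit x (real N * x $ fst_ix))\<bar> < \<epsilon>"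
proof -
  obtain R' U where U: "open U" "R_dom E \<subseteq> U" "Ck_on 0 U R'" "\<And>y. y \<in> R_dom E \<Longrightarrow> R' y = R y"
    using R unfolding smooth_on_def by (meson smooth_extensionE)
  define C where "C = (\<lambda>(x, t). R_limit x t) ` (fund_dom d E \<times> {0..1})"
  have fund: "fund_dom d E \<subseteq> E" by (auto simp: fund_dom_def)
  have "compact (fund_dom d E \<times> {0..1::real})"
    using compact_fund_dom[OF compact_K] E_def by (intro compact_Times) auto
  then have "compact C"
    unfolding C_def
    by (intro compact_continuous_image continuous_on_subset[OF continuous_R_limit]) (use fund in auto)
  moreover have "C \<subseteq> U"
    unfolding C_def
    by (rule image_subsetI) (use subsetD[OF U(2) R_limit_in_R_dom] fund in auto)
  moreover have "continuous_on U R'" using U(3) by simp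
  ultimately obtain \<eta> where \<eta>: "\<eta> > 0"
      "\<And>c y. c \<in> C \<Longrightarrow> dist y c < \<eta> \<Longrightarrow> y \<in> U \<and> dist (R' y) (R' c) < \<epsilon>"
    using continuous_uniform_near_compact[OF _ _ U(1) _ \<epsilon>] by blast
  show ?thesis
    using vanishing_eventually[OF vanishing_R_arg \<eta>(1)]
  proof eventually_elim
    case (elim N)
    show ?case
    proof
      fix x assume x: "x \<in> fund_dom d E"
      then have xE: "x \<in> E" using fund by blast
      let ?c = "R_limit x (real N * x $ fst_ix)"
      \<comment> \<open>Time periodicity brings the unbounded time back to \<open>{0..1}\<close>,
        the range used in \<open>C\<close>.\<close>
      have "R_limit x (frac (real N * x $ fst_ix)) \<in> C"
        using x frac_lt_1[of "real N * x $ fst_ix"] unfolding C_def by force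
      then have "?c \<in> C" by (simp add: R_limit_frac[OF xE])
      then have "dist (R' (R_arg E (F N) x)) (R' ?c) < \<epsilon>"
        using \<eta>(2) elim xE by (simp add: dist_norm)
      then show "\<bar>R (R_arg E (F N) x) - R ?c\<bar> < \<epsilon>"
        using U(4)[OF R_arg_in_R_dom[OF xE, of "F N"]] U(4)[OF R_limit_in_R_dom[OF xE]]
        by (simp add: dist_real_def)
    qed
  qed
qed

text \<open>Half of \<epsilon> is spent on the \<open>L\<close> term and half on the
  \<open>R\<close> term. Once \<open>L\<close> has removed the time and space derivatives of
  \<gamma>, the main part is (L3) at time \<open>N * x $ fst_ix\<close>.\<close>

lemma eventually_thickening:
  fixes L :: "'n rvec \<Rightarrow> 'm rvec \<Rightarrow>\<^sub>L real"
  assumes R: "semilinear_in_x1 d E Rel L R"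
    and L2: "\<And>x t. x \<in> E \<Longrightarrow>
      blinfun_apply (L x) (\<gamma> x t) = 0 \<and> blinfun_apply (partial_on E fst_ix L x) (\<gamma> x t) = 0"
    and L3: "\<And>x t. x \<in> E \<Longrightarrow>
      blinfun_apply (L x) (partial_on E fst_ix (partial_on E fst_ix f) x + \<delta> x t) + R (R_limit x t) = 0"
    and \<epsilon>: "\<epsilon> > 0"
  shows "\<forall>\<^sub>F N in sequentially. \<forall>x\<in>E. jet2 E (F N) x \<in> thickening E L R \<epsilon>"
proof -
  have L: "L \<in> Cinf_per d E" and Rs: "smooth_on (R_dom E) R"
    using R by (auto simp: semilinear_in_x1_def)
  obtain B where "\<And>x. x \<in> E \<Longrightarrow> norm (L x) \<le> B" using Cinf_per_bounded[OF L] by blast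
  from vanishing_eventually[OF vanishing_blinfun[OF vanishing_partial2_F_first[OF refl] this] half_gt_zero[OF \<epsilon>]]
  have "\<forall>\<^sub>F N in sequentially. N > 0 \<and> (\<forall>x\<in>E. \<bar>blinfun_apply (L x)
    (partial_on E fst_ix (partial_on E fst_ix (F N)) x - (partial_on E fst_ix (partial_on E fst_ix f) x
    + real N *\<^sub>R gr (td \<gamma>) N x + 2 *\<^sub>R gr (pd E fst_ix \<gamma>) N x + gr \<delta> N x))\<bar> < \<epsilon> / 2)"
    by simp
  moreover have "\<forall>\<^sub>F N in sequentially. \<forall>x\<in>fund_dom d E.
    \<bar>R (R_arg E (F N) x) - R (R_limit x (real N * x $ fst_ix))\<bar> < \<epsilon> / 2"
    by (rule R_uniformly_close[OF Rs]) (use \<epsilon> in simp)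
  ultimately show ?thesis
  proof eventually_elim
    case (elim N)
    have fund: "\<bar>semilinear_expr L R (jet2 E (F N) x)\<bar> < \<epsilon>" if x: "x \<in> fund_dom d E" for x
    proof -
      have xE: "x \<in> E" using x by (simp add: fund_dom_def)
      note s = well_adapted_smooth[OF \<gamma>]
      have "blinfun_apply (L x) (gr (td \<gamma>) N x) = 0"
        by (rule blinfun_annihilates_td[OF s xE]) (use L2[OF xE] in blast)
      moreover have "blinfun_apply (L x) (gr (pd E fst_ix \<gamma>) N x) = 0"
        by (rule blinfun_annihilates_pd[OF Cinf_per_smooth[OF L] s xE]) (use L2 xE in blast)+
      ultimately show ?thesis
        using bspec[OF conjunct2[OF elim(1)] xE] bspec[OF elim(2) x] L3[OF xE, of "real N * x $ fst_ix"]
        by (simp add: semilinear_expr_jet2 blinfun.add_right blinfun.diff_right blinfun.scaleR_right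
            del: less_divide_eq_numeral1)
    qed
    \<comment> \<open>Periodicity of \<open>F N\<close> carries the bound from the fundamental
      domain to all of \<open>E\<close>.\<close>
    have "\<bar>semilinear_expr L R (jet2 E (F N) x)\<bar> < \<epsilon>" if x: "x \<in> E" for x
    proof -
      obtain k where "k \<in> lattice_vecs d" "x + k \<in> fund_dom d E"
        using fund_dom_translate x E_def by blast
      then show ?thesis
        using fund semilinear_expr_translate[OF R F_Cinf x] elim by metis
    qed
    then have "- \<epsilon> < semilinear_expr L R (jet2 E (F N) x)"
      "semilinear_expr L R (jet2 E (F N) x) < \<epsilon>" if "x \<in> E" for x
      using that by (fastforce dest: abs_less_iff[THEN iffD1])+
    then show ?case by (simp add: thickening_def jet2_in_J2)
  qed
qed

text \<open>A supremum of values below a bound may attain it, so the pointwise estimate is made with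
  \<open>\<epsilon> / 2\<close>.\<close>

lemma eventually_C0_norm:
  assumes "\<epsilon> > 0"
  shows "\<forall>\<^sub>F N in sequentially. C0_norm E (\<lambda>x. F N x - f x) < ennreal \<epsilon>"
  using vanishing_eventually[OF vanishing_F half_gt_zero[OF assms]]
proof eventually_elim
  case (elim N)
  then have "C0_norm E (\<lambda>x. F N x - f x) \<le> ennreal (\<epsilon> / 2)"
    unfolding C0_norm_def by (intro SUP_least ennreal_leI) (auto simp: less_imp_le)
  also have "\<dots> < ennreal \<epsilon>" using assms by (simp add: ennreal_less_iff)
  finally show ?case .
qed

end

theorem proposition2p4:
  fixes d :: nat
    and K E :: "'n::{finite,linorder} rvec set"
    and Rel :: "('n, 'm::finite) jet set"
    and L :: "'n rvec \<Rightarrow> 'm rvec \<Rightarrow>\<^sub>L real"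
    and R :: "'n rvec \<times> ('n, 'm) cjet \<times> 'm rvec \<times> ('n, 'm) fam \<Rightarrow> real"
    and f :: "'n rvec \<Rightarrow> 'm rvec"
    and \<gamma> \<delta> :: "'n rvec \<Rightarrow> real \<Rightarrow> 'm rvec"
    and F :: "nat \<Rightarrow> 'n rvec \<Rightarrow> 'm rvec"
  assumes "d \<le> CARD('n)"
    and "K \<subseteq> first_space d" and "compact K"
    and "E = cyl d K"
    and "partials_well_defined E"
    and "semilinear_in_x1 d E Rel L R"
    and "f \<in> Cinf_per d E"
    and "well_adapted d E \<gamma>" and "well_adapted d E \<delta>"
    and L1: "\<And>x. x \<in> E \<Longrightarrow> loop_mean (\<gamma> x) = 0 \<and> loop_mean (\<delta> x) = 0"
    and L2: "\<And>x t. x \<in> E \<Longrightarrow>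
      blinfun_apply (L x) (\<gamma> x t) = 0 \<and> blinfun_apply (partial_on E fst_ix L x) (\<gamma> x t) = 0"
    and L3: "\<And>x t s0 s1 s2. x \<in> E \<Longrightarrow> jet2 E f x = (x, s0, s1, s2) \<Longrightarrow>
      blinfun_apply (L x) (s2 $ fst_ix $ fst_ix + \<delta> x t)
      + R (x, check (x, s0, s1, s2), s1 $ fst_ix + \<gamma> x t,
           tail (s2 $ fst_ix) + tail (\<chi> j. partial_on E j (\<lambda>y. \<gamma> y t) x)) = 0"
    and F: "\<And>N x. N > 0 \<Longrightarrow> x \<in> E \<Longrightarrow>
      F N x = f x + (1 / real N) *\<^sub>R loop_Int (\<gamma> x) (real N * x $ fst_ix)
      + (1 / (real N)\<^sup>2) *\<^sub>R loop_Int (loop_Int (\<delta> x)) (real N * x $ fst_ix)"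
  shows "(\<forall>N>0. F N \<in> Cinf_per d E) \<and>
    (\<forall>\<epsilon>>0. \<exists>N0. \<forall>N\<ge>N0. N > 0 \<longrightarrow>
       C0_norm E (\<lambda>x. F N x - f x) < ennreal \<epsilon> \<and>
       (\<forall>x\<in>E. jet2 E (F N) x \<in> thickening E L R \<epsilon>))"
proof -
  interpret corrugation d K E f \<gamma> \<delta> F
    by unfold_locales (use assms in auto)
  \<comment> \<open>The hypothesis (L3) speaks of the components of the jet of \<open>f\<close>;
    here it is expressed through \<open>R_limit\<close>.\<close>
  have L3': "blinfun_apply (L x) (partial_on E fst_ix (partial_on E fst_ix f) x + \<delta> x t)
      + R (R_limit x t) = 0" if x: "x \<in> E" for x t
  proof -
    obtain s0 s1 s2 where s: "jet2 E f x = (x, s0, s1, s2)" by (simp add: jet2_def)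
    then have "s2 $ fst_ix $ fst_ix = partial_on E fst_ix (partial_on E fst_ix f) x"
      by (auto simp: jet2_def)
    with L3[OF x s, of t] show ?thesis by (simp add: R_limit_def R_arg_jet2[OF s] pd_def)
  qed
  show ?thesis
  proof (intro conjI allI impI)
    show "F N \<in> Cinf_per d E" if "N > 0" for N
      by (rule F_Cinf[OF that])
    show "\<exists>N0. \<forall>N\<ge>N0. N > 0 \<longrightarrow>
       C0_norm E (\<lambda>x. F N x - f x) < ennreal \<epsilon> \<and>
       (\<forall>x\<in>E. jet2 E (F N) x \<in> thickening E L R \<epsilon>)" if "\<epsilon> > 0" for \<epsilon>
      using eventually_conj[OF eventually_C0_norm[OF that]
          eventually_thickening[OF assms(6) L2 L3' that]]
      unfolding eventually_sequentially by blast
  qed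
qed

end
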